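(* Let $K_1,\dots,K_n\in C^2_+$ be convex bodies in $\mathbb{R}^n$ such that $K_i=\lambda_iK$ for some convex body $K\in C^2_+$ and $\lambda_i>0$, $i=1,\dots,n$. For all $\phi_1,\dots,\phi_n\in Conc(0,\infty)$, $$as^*(\phi_1,K_1;\cdots;\phi_n,K_n)=as(\phi_1,K_1^\circ;\cdots;\phi_n,K_n^\circ).$$ In particular, $as^*(\phi_1,K;\cdots;\phi_n,K)=as(\phi_1,K^\circ;\cdots;\phi_n,K^\circ)$.
   Context: Let $n\ge2$. $S^{n-1}$ is the unit sphere of $\mathbb{R}^n$ and $\sigma$ the usual surface area measure on it. $K\in C^2_+$ means that $K$ is a convex body in $\mathbb{R}^n$ with the origin in its interior and with $C^2$ boundary having everywhere strictly positive Gaussian curvature. $h_K(u)=\max_{x\in K}\langle x,u\rangle$ is the support function, and the curvature function $f_K(u)$, $u\in S^{n-1}$, is the reciprocal of the Gauss curvature of $\partial K$ at the point with outer unit normal $u$. The polar body is $K^\circ=\{y\in\mathbb{R}^n:\langle x,y\rangle\le1\ \forall x\in K\}$. $Conc(0,\infty)$ is the set of functions $\phi:(0,\infty)\to(0,\infty)$ such that either $\phi$ is a nonzero constant function, or $\phi$ is concave with $\lim_{t\to0}\phi(t)=0$ and $\lim_{t\to\infty}\phi(t)/t=0$. For $\phi_i\in Conc(0,\infty)$ and $K_i\in C^2_+$, the general mixed $L_\phi$- and $L_\phi^*$-affine surface areas are $$as(\phi_1,K_1;\cdots;\phi_n,K_n)=\int_{S^{n-1}}\prod_{i=1}^n\left[\phi_i\!\left(\frac{1}{f_{K_i}(u)h_{K_i}^{n+1}(u)}\right)h_{K_i}(u)f_{K_i}(u)\right]^{\frac1n}d\sigma(u),$$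 $$as^*(\phi_1,K_1;\cdots;\phi_n,K_n)=\int_{S^{n-1}}\prod_{i=1}^n\left[\frac{\phi_i\big(f_{K_i}(u)h_{K_i}^{n+1}(u)\big)}{h_{K_i}(u)^n}\right]^{\frac1n}d\sigma(u).$$ *)

theory Defs
  imports "HOL-Analysis.Analysis"
begin

section \<open>Convex bodies of class C2 with positive Gauss curvature\<close>

definition convex_body :: "'a::euclidean_space set \<Rightarrow> bool" where
  "convex_body K \<longleftrightarrow> compact K \<and> convex K \<and> interior K \<noteq> {}"

text \<open>\<open>G\<close> is the gradient and \<open>H\<close> the Hessian matrix of \<open>g\<close>.\<close>

definition C2_fun_on :: "(real^'n \<Rightarrow> real) \<Rightarrow> (real^'n) set \<Rightarrow> (real^'n \<Rightarrow> real^'n) \<Rightarrow> bool" where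
  "C2_fun_on g U G \<longleftrightarrow>
     (\<exists>H :: real^'n \<Rightarrow> real^'n^'n.
        (\<forall>x\<in>U. (g has_derivative (\<lambda>v. G x \<bullet> v)) (at x)) \<and>
        (\<forall>x\<in>U. (G has_derivative (\<lambda>v. H x *v v)) (at x)) \<and>
        continuous_on U H)"

definition C2_boundary :: "(real^'n) set \<Rightarrow> bool" where
  "C2_boundary K \<longleftrightarrow>
     (\<forall>x\<in>frontier K. \<exists>U g G. open U \<and> x \<in> U \<and> C2_fun_on g U G \<and>
        (\<forall>y\<in>U. G y \<noteq> 0) \<and> frontier K \<inter> U = {y\<in>U. g y = 0})"

text \<open>For a convex body with \<open>C2\<close> boundary, the outer unit normal exists and is
  unique at every boundary point.\<close>

definition outer_normal :: "'a::euclidean_space set \<Rightarrow> 'a \<Rightarrow> 'a" where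
  "outer_normal K x = (THE u. norm u = 1 \<and> (\<forall>y\<in>K. (y - x) \<bullet> u \<le> 0))"

text \<open>The Gauss curvature at \<open>x\<close> is the determinant of the differential of the Gauss map
  (the Weingarten map) on the tangent space \<open>T\<close>, the orthogonal complement of the normal \<open>\<nu>\<close>.
  A Frechet derivative \<open>W\<close> of the Gauss map within the boundary is determined on \<open>T\<close> only, and
  maps \<open>T\<close> to itself; the linear map below agrees with \<open>W\<close> on \<open>T\<close> and fixes \<open>\<nu>\<close>, so that its
  determinant is that of \<open>W\<close> restricted to \<open>T\<close>, whichever derivative \<open>W\<close> is chosen.
  With respect to the outer normal the principal curvatures of a convex body are nonnegative.\<close>

definition gauss_curvature :: "(real^'n) set \<Rightarrow> real^'n \<Rightarrow> real" where
  "gauss_curvature K x =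
     (let \<nu> = outer_normal K x;
          W = frechet_derivative (outer_normal K) (at x within frontier K)
      in det (matrix (\<lambda>v. W (v - (v \<bullet> \<nu>) *\<^sub>R \<nu>) + (v \<bullet> \<nu>) *\<^sub>R \<nu>)))"

definition C2_plus :: "(real^'n) set set" where
  "C2_plus = {K. convex_body K \<and> 0 \<in> interior K \<and> C2_boundary K \<and>
                 (\<forall>x\<in>frontier K. 0 < gauss_curvature K x)}"

definition support_fun :: "'a::euclidean_space set \<Rightarrow> 'a \<Rightarrow> real" where
  "support_fun K u = (SUP x\<in>K. x \<bullet> u)"

definition curvature_fun :: "(real^'n) set \<Rightarrow> real^'n \<Rightarrow> real" where
  "curvature_fun K u = 1 / gauss_curvature K (THE x. x \<in> frontier K \<and> outer_normal K x = u)"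

definition polar_body :: "'a::euclidean_space set \<Rightarrow> 'a set" where
  "polar_body K = {y. \<forall>x\<in>K. x \<bullet> y \<le> 1}"

section \<open>Surface area measure on the unit sphere\<close>

text \<open>The surface measure of integration in polar coordinates: the area of a Borel set \<open>A\<close> of
  directions is \<open>n\<close> times the volume of the cone \<open>{r u | u \<in> A, 0 < r < 1}\<close>.
  Note \<open>sgn x = x /\<^sub>R norm x\<close>.\<close>

definition sphere_measure :: "'a::euclidean_space measure" where
  "sphere_measure =
     scale_measure (of_nat DIM('a))
       (distr (restrict_space lborel (ball 0 1 - {0})) (restrict_space borel (sphere 0 1)) sgn)"

lemma emeasure_sphere_measure:
  fixes A :: "'a::euclidean_space set"
  assumes "A \<in> sets borel" "A \<subseteq> sphere 0 1"
  shows "emeasure sphere_measure A =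
           of_nat DIM('a) * emeasure lborel {x\<in>ball 0 1 - {0}. sgn x \<in> A}"
proof -
  let ?M = "restrict_space lborel (ball 0 1 - {0} :: 'a set)"
  have "sgn \<in> borel_measurable (borel :: 'a measure)"
    unfolding sgn_div_norm by measurable
  then have "sgn \<in> measurable ?M (borel :: 'a measure)"
    by (intro measurable_restrict_space1) simp
  then have m: "sgn \<in> measurable ?M (restrict_space borel (sphere 0 1 :: 'a set))"
    by (intro measurable_restrict_space2) (auto simp: space_restrict_space norm_sgn)
  have A: "A \<in> sets (restrict_space borel (sphere 0 1))"
    using assms by (auto simp: sets_restrict_space_iff)
  have "emeasure (distr ?M (restrict_space borel (sphere 0 1)) sgn) A = emeasure ?M (sgn -` A \<inter> space ?M)"
    by (rule emeasure_distr[OF m A])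
  also have "sgn -` A \<inter> space ?M = {x\<in>ball 0 1 - {0}. sgn x \<in> A}"
    by (auto simp: space_restrict_space)
  also have "emeasure ?M \<dots> = emeasure lborel {x\<in>ball 0 1 - {0}. sgn x \<in> A}"
    by (rule emeasure_restrict_space) auto
  finally show ?thesis
    by (simp add: sphere_measure_def)
qed

section \<open>Mixed affine surface areas\<close>

text \<open>Elements of \<open>Conc\<close> are functions on the open half-line; their values outside
  are irrelevant.\<close>

definition Conc :: "(real \<Rightarrow> real) set" where
  "Conc = {\<phi>. (\<forall>t>0. 0 < \<phi> t) \<and>
     ((\<exists>c. c \<noteq> 0 \<and> (\<forall>t>0. \<phi> t = c)) \<or>
      (concave_on {0<..} \<phi> \<and> (\<phi> \<longlongrightarrow> 0) (at_right 0) \<and> ((\<lambda>t. \<phi> t / t) \<longlongrightarrow> 0) at_top))}"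

definition mixed_affine_area ::
  "(nat \<Rightarrow> real \<Rightarrow> real) \<Rightarrow> (nat \<Rightarrow> (real^'n) set) \<Rightarrow> real" where
  "mixed_affine_area \<phi> K =
     (LINT u|sphere_measure.
        (\<Prod>i=1..CARD('n).
           (\<phi> i (1 / (curvature_fun (K i) u * support_fun (K i) u ^ (CARD('n) + 1)))
             * support_fun (K i) u * curvature_fun (K i) u) powr (1 / real CARD('n))))"

definition mixed_affine_area_star ::
  "(nat \<Rightarrow> real \<Rightarrow> real) \<Rightarrow> (nat \<Rightarrow> (real^'n) set) \<Rightarrow> real" where
  "mixed_affine_area_star \<phi> K =
     (LINT u|sphere_measure.
        (\<Prod>i=1..CARD('n).
           (\<phi> i (curvature_fun (K i) u * support_fun (K i) u ^ (CARD('n) + 1))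
             / support_fun (K i) u ^ CARD('n)) powr (1 / real CARD('n))))"

end

theory Submission
  imports Defs
begin

text \<open>Write \<open>h\<close> for support functions, \<open>K\<degree>\<close> for the polar body and let \<open>\<Psi>\<close> be the gradient of
  \<open>(h K\<degree>)\<^sup>2 / 2\<close>. For \<open>K\<close> in \<open>C2_plus\<close> this is a positively homogeneous bijection off the
  origin which maps a boundary point of \<open>K\<close> to an outer normal vector there; its inverse is the same
  map for \<open>K\<degree>\<close>, and its Jacobian \<open>J\<close> at a point \<open>x\<close> of the boundary is the Gauss curvature times
  \<open>norm (\<Psi> x) ^ (n + 1)\<close>. With \<open>u = sgn (\<Psi> v)\<close> this says
  \<open>f K u * h K u ^ (n + 1) = 1 / J v\<close> and, by the inverse function theorem,
  \<open>f K\<degree> v * h K\<degree> v ^ (n + 1) = J v\<close>. The substitution \<open>u = sgn (\<Psi> v)\<close> on the sphere has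
  density \<open>J v / norm (\<Psi> v) ^ n\<close>, and it turns the integrand of one affine surface area
  into that of the other; dilating \<open>K\<close> by \<open>l\<close> merely divides \<open>\<Psi>\<close> by \<open>l\<^sup>2\<close>.\<close>

section \<open>Change of variables for an arbitrary finite index type\<close>

text \<open>Half the squared gauge is used because its gradient is homogeneous of degree one and can
  therefore be a bijection with invertible derivative; the gradient of the gauge itself is constant
  along rays, so its derivative is singular. The exponent \<open>n + 1\<close> is
  \<open>n - 1\<close> from normalising \<Psi> on the tangent space plus 2 from the radial
  direction: by Euler's identity the derivative maps \<open>x\<close> to \<open>\<Psi> x\<close>,
  whose normal component is \<open>norm (\<Psi> x) ^ 2\<close> times that of \<open>x\<close>. The
  obstacle is the regularity of the polar, whose curvature enters although membership in
  \<open>C2_plus\<close> is not established for it. The notion carried through is pointwise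
  differentiability of \<Psi> with positive Jacobian, which passes to the inverse map. Continuity of
  the Jacobian is not part of it, so measurability is proved separately and the integral identities
  are stated without integrability assumptions. One substitution has to serve all \<open>n\<close>
  factors. This is where dilates of a common body enter: they share the direction of \<Psi>, and the
  powers of \<open>l\<close> in Jacobian and support function cancel.\<close>

text \<open>The library proves the change of variables formula only for well-ordered index types, so a
  general finite type is replaced by a well-ordered copy.\<close>

typedef 'a ordered = "{..<CARD('a::finite)}"
  by (rule exI[of _ 0]) simp

instantiation ordered :: (finite) linorder
begin
definition less_eq_ordered :: "'a ordered \<Rightarrow> 'a ordered \<Rightarrow> bool" where
  "less_eq_ordered a b \<longleftrightarrow> Rep_ordered a \<le> Rep_ordered b"
definition less_ordered :: "'a ordered \<Rightarrow> 'a ordered \<Rightarrow> bool" where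
  "less_ordered a b \<longleftrightarrow> Rep_ordered a < Rep_ordered b"
instance
  by standard (auto simp: less_eq_ordered_def less_ordered_def Rep_ordered_inject)
end

instance ordered :: (finite) wellorder
proof
  fix P :: "'a ordered \<Rightarrow> bool" and a :: "'a ordered"
  assume step: "\<And>x. (\<And>y. y < x \<Longrightarrow> P y) \<Longrightarrow> P x"
  show "P a"
    by (induction "Rep_ordered a" arbitrary: a rule: less_induct)
       (use step in \<open>auto simp: less_ordered_def\<close>)
qed

instance ordered :: (finite) finite
  by standard (metis Abs_ordered_cases ex_new_if_finite finite_imageI finite_lessThan image_eqI)

lemma card_ordered: "CARD('a::finite ordered) = CARD('a)"
  using type_definition.card[OF type_definition_ordered] by simp

lemma ordered_bij_exists: "\<exists>f :: 'a::finite \<Rightarrow> 'a ordered. bij f"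
  using finite_same_card_bij[of "UNIV :: 'a set" "UNIV :: 'a ordered set"]
  by (simp add: card_ordered)

text \<open>Conjugation by \<open>\<pi>\<close> matches the permutations of the two index types and
  preserves signs, so the Leibniz sums agree term by term.\<close>

lemma det_reindex:
  fixes A :: "'a::comm_ring_1^'n^'n" and \<pi> :: "'m::finite \<Rightarrow> 'n"
  assumes "bij \<pi>"
  shows "det (\<chi> i j. A $ \<pi> i $ \<pi> j) = det A"
proof -
  let ?P = "{p. p permutes (UNIV :: 'm set)}" and ?Q = "{p. p permutes (UNIV :: 'n set)}"
  have inj: "inj \<pi>" and surj: "surj \<pi>" using assms by (auto simp: bij_def)
  let ?m = "map_permutation UNIV \<pi>"
  have m: "?m p (\<pi> i) = \<pi> (p i)" for p i
    using inj by (simp add: map_permutation_apply)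
  have "bij_betw ?m ?P ?Q"
  proof (rule bij_betw_byWitness[where f' = "map_permutation UNIV (inv \<pi>)"])
    have inv: "range (inv \<pi>) = UNIV" "inv (inv \<pi>) = \<pi>"
      using assms by (simp_all add: bij_imp_bij_inv bij_is_surj inv_inv_eq)
    have "map_permutation UNIV (inv \<pi>) (?m p) = p" if "p permutes UNIV" for p
      using inj by (simp add: map_permutation_def restrict_id_def fun_eq_iff surj inv)
    then show "\<forall>p\<in>?P. map_permutation UNIV (inv \<pi>) (?m p) = p" by blast
    have "?m (map_permutation UNIV (inv \<pi>) p) = p" if "p permutes UNIV" for p
      by (simp add: map_permutation_def restrict_id_def fun_eq_iff surj surj_f_inv_f inv)
    then show "\<forall>p\<in>?Q. ?m (map_permutation UNIV (inv \<pi>) p) = p" by blast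
    show "?m ` ?P \<subseteq> ?Q"
      using map_permutation_permutes[OF assms] by auto
    show "map_permutation UNIV (inv \<pi>) ` ?Q \<subseteq> ?P"
      using map_permutation_permutes[OF bij_imp_bij_inv[OF assms]] by auto
  qed
  then have "det A = (\<Sum>p\<in>?P. of_int (sign (?m p)) * (\<Prod>i\<in>UNIV. A $ i $ ?m p i))"
    unfolding det_def by (rule sum.reindex_bij_betw[symmetric])
  also have "\<dots> = (\<Sum>p\<in>?P. of_int (sign p) * (\<Prod>i\<in>UNIV. A $ \<pi> i $ \<pi> (p i)))"
  proof (rule sum.cong[OF refl])
    fix p assume "p \<in> ?P"
    then have "sign (?m p) = sign p"
      using sign_map_permutation[of \<pi> UNIV p] inj by simp
    moreover have "(\<Prod>i\<in>UNIV. A $ i $ ?m p i) = (\<Prod>i\<in>UNIV. A $ \<pi> i $ ?m p (\<pi> i))"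
      using prod.reindex_bij_betw[OF assms, symmetric] .
    ultimately show "of_int (sign (?m p)) * (\<Prod>i\<in>UNIV. A $ i $ ?m p i)
        = of_int (sign p) * (\<Prod>i\<in>UNIV. A $ \<pi> i $ \<pi> (p i))"
      by (simp add: m)
  qed
  finally show ?thesis by (simp add: det_def)
qed

text \<open>Relabelling coordinates turns boxes into boxes with the same side lengths, and
  \<open>lborel\<close> is determined by its values on boxes.\<close>

lemma lborel_distr_reindex:
  fixes \<pi> :: "'m::finite \<Rightarrow> 'n::finite"
  assumes "bij \<pi>"
  shows "distr (lborel :: (real^'n) measure) borel (\<lambda>x. \<chi> i. x $ \<pi> i) = (lborel :: (real^'m) measure)"
proof (rule lborel_eqI[symmetric])
  let ?t = "\<lambda>x::real^'n. (\<chi> i. x $ \<pi> i) :: real^'m"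
  let ?s = "\<lambda>x::real^'m. (\<chi> i. x $ inv \<pi> i) :: real^'n"
  have inv: "inv \<pi> (\<pi> i) = i" "\<pi> (inv \<pi> j) = j" for i j
    using assms by (auto simp: bij_is_inj bij_is_surj surj_f_inv_f)
  have meas: "?t \<in> borel_measurable borel"
    by (intro borel_measurable_continuous_onI continuous_intros)
  fix l u :: "real^'m" assume le: "\<And>b. b \<in> Basis \<Longrightarrow> l \<bullet> b \<le> u \<bullet> b"
  have lei: "l $ i \<le> u $ i" for i
    using le[of "axis i 1"] by (simp add: inner_axis axis_in_Basis_iff)
  have pb: "(\<Prod>b\<in>Basis. x \<bullet> b) = (\<Prod>i\<in>UNIV. x $ i)" for x :: "real^'k"
  proof -
    have "(Basis :: (real^'k) set) = range (\<lambda>i. axis i 1)" by (auto simp: Basis_vec_def)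
    moreover have inj: "inj (\<lambda>i::'k. axis i (1::real))"
      by (simp add: inj_on_def axis_eq_axis)
    ultimately show ?thesis
      using prod.reindex[OF inj, of "\<lambda>b. x \<bullet> b"] by (simp add: inner_axis)
  qed
  have "?t -` box l u = box (?s l) (?s u)"
    by (auto simp: mem_box_cart inv) (metis inv)+
  then have "emeasure (distr lborel borel ?t) (box l u) = emeasure lborel (box (?s l) (?s u))"
    using meas by (simp add: emeasure_distr)
  also have "\<dots> = (\<Prod>b\<in>Basis. (?s u - ?s l) \<bullet> b)"
    by (rule emeasure_lborel_box) (auto simp: Basis_vec_def inner_axis lei)
  also have "(\<Prod>b\<in>Basis. (?s u - ?s l) \<bullet> b) = (\<Prod>i\<in>UNIV. (u - l) $ inv \<pi> i)"
    by (subst pb) simp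
  also have "\<dots> = (\<Prod>i\<in>UNIV. (u - l) $ i)"
    using prod.reindex_bij_betw[OF bij_imp_bij_inv[OF assms]] .
  finally show "emeasure (distr lborel borel ?t) (box l u) = (\<Prod>b\<in>Basis. (u - l) \<bullet> b)"
    by (simp add: pb)
qed simp


text \<open>Scalar functions enter the library formula as functions into \<open>real^1\<close>.
  Borel measurability lets integrability pass between the completed measure used there and
  \<open>lborel\<close>.\<close>

lemma set_lborel_change_of_variables_wellorder:
  fixes g :: "real^'n::{finite,wellorder} \<Rightarrow> real^'n::_" and f :: "real^'n::_ \<Rightarrow> real"
  assumes S: "S \<in> sets borel"
    and der: "\<And>x. x \<in> S \<Longrightarrow> (g has_derivative g' x) (at x within S)"
    and inj: "inj_on g S"
    and f: "set_borel_measurable borel (g ` S) f"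
    and fg: "set_borel_measurable borel S (\<lambda>x. \<bar>det (matrix (g' x))\<bar> * f (g x))"
  shows "(LINT x:S|lborel. \<bar>det (matrix (g' x))\<bar> * f (g x)) = (LINT x:g`S|lborel. f x)"
proof -
  let ?F = "\<lambda>x. \<bar>det (matrix (g' x))\<bar> * f (g x)"
  have lebesgue: "h absolutely_integrable_on T \<longleftrightarrow> set_integrable lborel T h"
    if "set_borel_measurable borel T h" for T and h :: "real^'n::_ \<Rightarrow> real"
    using that unfolding set_integrable_def set_borel_measurable_def
    by (intro integrable_completion) simp
  have "(\<lambda>x. \<bar>det (matrix (g' x))\<bar> *\<^sub>R (vec (f (g x)) :: real^1)) absolutely_integrable_on S \<and>
      integral S (\<lambda>x. \<bar>det (matrix (g' x))\<bar> *\<^sub>R (vec (f (g x)) :: real^1)) = vec b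
      \<longleftrightarrow> (\<lambda>x. vec (f x) :: real^1) absolutely_integrable_on (g ` S) \<and>
        integral (g ` S) (\<lambda>x. vec (f x) :: real^1) = vec b" for b
    using S by (intro has_absolute_integral_change_of_variables[OF _ der inj]) auto
  then have *: "?F absolutely_integrable_on S \<and> integral S ?F = b
      \<longleftrightarrow> f absolutely_integrable_on (g ` S) \<and> integral (g ` S) f = b" for b
    by (simp add: absolutely_integrable_on_1_iff integral_on_1_eq)
  show ?thesis
  proof (cases "set_integrable lborel S ?F")
    case True
    then have "set_integrable lborel (g ` S) f" "integral (g ` S) f = integral S ?F"
      using * lebesgue[OF f] lebesgue[OF fg] by blast+
    with True show ?thesis by (simp add: set_borel_integral_eq_integral)
  next
    case False
    \<comment> \<open>Integrability fails on both sides together, and both integrals then have the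
      default value 0.\<close>
    then have "\<not> set_integrable lborel (g ` S) f"
      using * lebesgue[OF f] lebesgue[OF fg] by blast
    with False show ?thesis
      by (simp add: set_lebesgue_integral_def set_integrable_def not_integrable_integral_eq)
  qed
qed

text \<open>Conjugating \<open>g\<close> by the relabelling \<open>to\<close>, \<open>fro\<close>
  reduces to the well-ordered copy; this changes neither volumes nor Jacobian determinants.\<close>

proposition set_lborel_change_of_variables:
  fixes g :: "real^'n \<Rightarrow> real^'n" and f :: "real^'n \<Rightarrow> real"
  assumes S: "S \<in> sets borel"
    and der: "\<And>x. x \<in> S \<Longrightarrow> (g has_derivative g' x) (at x within S)"
    and inj: "inj_on g S"
    and f: "set_borel_measurable borel (g ` S) f"
    and fg: "set_borel_measurable borel S (\<lambda>x. \<bar>det (matrix (g' x))\<bar> * f (g x))"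
  shows "(LINT x:S|lborel. \<bar>det (matrix (g' x))\<bar> * f (g x)) = (LINT x:g`S|lborel. f x)"
proof -
  obtain \<rho> :: "'n \<Rightarrow> 'n ordered" where \<rho>: "bij \<rho>" using ordered_bij_exists by blast
  define to :: "real^'n \<Rightarrow> real^('n ordered)" where "to x = (\<chi> i. x $ inv \<rho> i)" for x
  define fro :: "real^('n ordered) \<Rightarrow> real^'n" where "fro x = (\<chi> i. x $ \<rho> i)" for x
  have inv\<rho>: "inv \<rho> (\<rho> i) = i" "\<rho> (inv \<rho> j) = j" for i j
    using \<rho> by (auto simp: bij_is_inj bij_is_surj surj_f_inv_f)
  have fro_to [simp]: "fro (to x) = x" and to_fro [simp]: "to (fro y) = y" for x y
    by (simp_all add: to_def fro_def inv\<rho>)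
  have lin: "linear to" "linear fro"
    by (auto simp: linear_iff to_def fro_def vec_eq_iff)
  then have bl: "bounded_linear to" "bounded_linear fro"
    by (simp_all add: linear_conv_bounded_linear)
  have meas: "fro \<in> borel_measurable borel"
    using bl(2) by (intro borel_measurable_continuous_onI) (simp add: linear_continuous_on)
  have ind: "indicator T (fro y) = (indicator (to ` T) y :: real)" for T y
  proof -
    have "to ` T = fro -` T" by (auto simp: image_iff, metis to_fro)
    then show ?thesis by (simp add: indicator_def)
  qed
  have transfer: "(LINT x:T|lborel. h x) = (LINT y:to ` T|lborel. h (fro y))"
    if h: "set_borel_measurable borel T h" for T and h :: "real^'n \<Rightarrow> real"
  proof -
    have "(LINT x:T|lborel. h x) = (LINT x|distr lborel borel fro. indicator T x *\<^sub>R h x)"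
      using lborel_distr_reindex[OF \<rho>] by (simp add: set_lebesgue_integral_def fro_def[abs_def])
    also have "\<dots> = (LINT y|lborel. indicator T (fro y) *\<^sub>R h (fro y))"
      using meas h by (intro integral_distr) (auto simp: set_borel_measurable_def)
    also have "\<dots> = (LINT y:to ` T|lborel. h (fro y))"
      unfolding set_lebesgue_integral_def
      by (simp add: ind)
    finally show ?thesis .
  qed
  have transfer_meas: "set_borel_measurable borel (to ` T) (\<lambda>y. h (fro y))"
    if "set_borel_measurable borel T h" for T and h :: "real^'n \<Rightarrow> real"
  proof -
    have "(\<lambda>y. indicator T (fro y) *\<^sub>R h (fro y)) \<in> borel_measurable borel"
      using measurable_compose[OF meas] that unfolding set_borel_measurable_def by blast
    then show ?thesis by (simp add: set_borel_measurable_def ind)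
  qed
  let ?G = "\<lambda>y. to (g (fro y))" and ?G' = "\<lambda>y. to \<circ> g' (fro y) \<circ> fro"
  have im: "?G ` to ` S = to ` g ` S" by force
  have det: "det (matrix (?G' y)) = det (matrix (g' (fro y)))" for y
  proof -
    have "fro (axis j 1) = axis (inv \<rho> j) 1" for j
      by (auto simp: fro_def axis_def vec_eq_iff inv\<rho>)
    note this[simp]
    have "matrix (?G' y) = (\<chi> i j. matrix (g' (fro y)) $ inv \<rho> i $ inv \<rho> j)"
      by (simp add: matrix_def to_def vec_eq_iff)
    then show ?thesis using det_reindex[OF bij_imp_bij_inv[OF \<rho>]] by simp
  qed
  have "(LINT x:S|lborel. \<bar>det (matrix (g' x))\<bar> * f (g x))
      = (LINT y:to ` S|lborel. \<bar>det (matrix (?G' y))\<bar> * (f \<circ> fro) (?G y))"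
    by (subst transfer[OF fg]) (simp add: det)
  also have "\<dots> = (LINT y:?G ` to ` S|lborel. (f \<circ> fro) y)"
  proof (rule set_lborel_change_of_variables_wellorder)
    have "to ` S = fro -` S" by (auto simp: image_iff, metis to_fro)
    then show "to ` S \<in> sets borel" using measurable_sets[OF meas S] by simp
    show "inj_on ?G (to ` S)"
      using inj by (auto simp: inj_on_def) (metis fro_to)
    show "(?G has_derivative ?G' y) (at y within to ` S)" if "y \<in> to ` S" for y
    proof -
      have d: "(g has_derivative g' (fro y)) (at (fro y) within fro ` to ` S)"
        using der[of "fro y"] that by (auto simp: image_image)
      have "((g \<circ> fro) has_derivative (g' (fro y) \<circ> fro)) (at y within to ` S)"
        using diff_chain_within[OF bounded_linear_imp_has_derivative[OF bl(2)] d] .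
      then have "((\<lambda>y. to ((g \<circ> fro) y)) has_derivative (\<lambda>v. to ((g' (fro y) \<circ> fro) v))) (at y within to ` S)"
        by (rule bounded_linear.has_derivative[OF bl(1)])
      then show ?thesis by (simp add: o_def)
    qed
    show "set_borel_measurable borel (?G ` to ` S) (f \<circ> fro)"
      using transfer_meas[OF f] by (simp add: im o_def)
    show "set_borel_measurable borel (to ` S) (\<lambda>x. \<bar>det (matrix (?G' x))\<bar> * (f \<circ> fro) (?G x))"
      using transfer_meas[OF fg] by (simp add: det)
  qed
  also have "\<dots> = (LINT x:g ` S|lborel. f x)"
    by (subst transfer[OF f]) (simp add: im o_def)
  finally show ?thesis .
qed


section \<open>Convex bodies, support functions and polarity\<close>

definition centered_body :: "'a::euclidean_space set \<Rightarrow> bool" where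
  "centered_body K \<longleftrightarrow> convex_body K \<and> 0 \<in> interior K"

text \<open>\<open>y\<close> is a subgradient at \<open>x\<close> of half the squared gauge of \<open>K\<close>.\<close>

definition dual_pair :: "'a::euclidean_space set \<Rightarrow> 'a \<Rightarrow> 'a \<Rightarrow> bool" where
  "dual_pair K x y \<longleftrightarrow> x \<bullet> y = (support_fun K y)\<^sup>2 \<and> support_fun (polar_body K) x = support_fun K y"

section \<open>Support functions of bodies around the origin\<close>

context
  fixes K :: "'a::euclidean_space set"
  assumes K: "centered_body K"
begin

lemma compact_body: "compact K" and convex_centered_body: "convex K" and zero_interior: "0 \<in> interior K"
  using K by (auto simp: centered_body_def convex_body_def)

lemma zero_mem: "0 \<in> K"
  using zero_interior interior_subset by blast

lemma bdd_above_support: "bdd_above ((\<lambda>x. x \<bullet> u) ` K)"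
  by (intro compact_imp_bounded bounded_imp_bdd_above compact_continuous_image compact_body continuous_intros)

lemma support_upper: "x \<in> K \<Longrightarrow> x \<bullet> u \<le> support_fun K u"
  unfolding support_fun_def by (rule cSUP_upper[OF _ bdd_above_support])

lemma support_attained: obtains x where "x \<in> K" "x \<bullet> u = support_fun K u"
proof -
  obtain x where x: "x \<in> K" "\<And>y. y \<in> K \<Longrightarrow> y \<bullet> u \<le> x \<bullet> u"
    using continuous_attains_sup[OF compact_body, of "\<lambda>x. x \<bullet> u"] zero_mem
      continuous_on_inner[OF continuous_on_id continuous_on_const] by fastforce
  have "support_fun K u = x \<bullet> u"
    unfolding support_fun_def by (rule cSup_eq_maximum) (use x in auto)
  with x that show ?thesis by auto
qed

lemma support_le_iff: "support_fun K u \<le> c \<longleftrightarrow> (\<forall>x\<in>K. x \<bullet> u \<le> c)"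
  by (metis order_trans support_attained support_upper)

lemma ball_subset_body: obtains r where "r > 0" "cball 0 r \<subseteq> K"
  using zero_interior by (auto simp: mem_interior_cball)

lemma support_lower: obtains r where "r > 0" "\<And>u. r * norm u \<le> support_fun K u"
proof -
  obtain r where r: "r > 0" "cball 0 r \<subseteq> K" by (rule ball_subset_body)
  have "r * norm u \<le> support_fun K u" for u
  proof -
    have "r *\<^sub>R sgn u \<in> K" using r by (intro subsetD[OF r(2)]) (auto simp: norm_sgn)
    from support_upper[OF this, of u] show ?thesis
      by (cases "u = 0") (auto simp: sgn_div_norm dot_square_norm power2_eq_square field_simps)
  qed
  with r that show ?thesis by blast
qed

lemma support_pos: "u \<noteq> 0 \<Longrightarrow> 0 < support_fun K u"
  using support_lower by (metis less_le_trans mult_pos_pos zero_less_norm_iff)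

lemma support_zero [simp]: "support_fun K 0 = 0"
  using support_attained[of 0] by auto

lemma support_eq_0_iff: "support_fun K u = 0 \<longleftrightarrow> u = 0"
  using support_pos[of u] by (cases "u = 0") auto

lemma support_scaleR: "0 \<le> c \<Longrightarrow> support_fun K (c *\<^sub>R u) = c * support_fun K u"
proof (rule antisym)
  assume c: "0 \<le> c"
  show "support_fun K (c *\<^sub>R u) \<le> c * support_fun K u"
    using c by (auto simp: support_le_iff intro: mult_left_mono support_upper)
  obtain x where "x \<in> K" "x \<bullet> u = support_fun K u" by (rule support_attained)
  with support_upper[of x "c *\<^sub>R u"] show "c * support_fun K u \<le> support_fun K (c *\<^sub>R u)" by auto
qed

lemma support_add: "support_fun K (u + v) \<le> support_fun K u + support_fun K v"
  by (auto simp: support_le_iff inner_add_right intro: add_mono support_upper)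

lemma continuous_support: "continuous_on S (support_fun K)"
proof -
  obtain B where B: "B > 0" "\<And>x. x \<in> K \<Longrightarrow> norm x \<le> B"
    using compact_imp_bounded[OF compact_body] by (auto simp: bounded_pos)
  have bd: "support_fun K u \<le> B * norm u" for u
    unfolding support_le_iff
  proof
    fix x assume "x \<in> K"
    have "x \<bullet> u \<le> norm x * norm u" by (rule norm_cauchy_schwarz)
    also have "\<dots> \<le> B * norm u" using B \<open>x \<in> K\<close> by (intro mult_right_mono) auto
    finally show "x \<bullet> u \<le> B * norm u" .
  qed
  have "\<bar>support_fun K u - support_fun K v\<bar> \<le> B * norm (u - v)" for u v
    using support_add[of v "u - v"] support_add[of u "v - u"] bd[of "u - v"] bd[of "v - u"]
    by (auto simp: abs_le_iff norm_minus_commute)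
  then have "B-lipschitz_on UNIV (support_fun K)"
    using B by (intro lipschitz_onI) (auto simp: dist_norm)
  then show ?thesis using lipschitz_on_continuous_on continuous_on_subset by blast
qed

lemma polar_iff: "y \<in> polar_body K \<longleftrightarrow> support_fun K y \<le> 1"
  by (auto simp: polar_body_def support_le_iff)

lemma polar_body_centered: "centered_body (polar_body K)"
proof -
  have eq: "polar_body K = (\<Inter>x\<in>K. {y. x \<bullet> y \<le> 1})" by (auto simp: polar_body_def)
  obtain r where r: "r > 0" "\<And>u. r * norm u \<le> support_fun K u" by (rule support_lower) blast
  have "closed (polar_body K)" unfolding eq by (intro closed_INT ballI closed_halfspace_le)
  moreover have "bounded (polar_body K)"
  proof (rule boundedI)
    fix y assume "y \<in> polar_body K"
    then have "r * norm y \<le> 1" using r(2)[of y] by (auto simp: polar_iff)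
    then show "norm y \<le> 1 / r" using r by (auto simp: field_simps)
  qed
  ultimately have "compact (polar_body K)" by (simp add: compact_eq_bounded_closed)
  moreover have "convex (polar_body K)" unfolding eq by (intro convex_INT convex_halfspace_le)
  moreover have "0 \<in> interior (polar_body K)"
  proof (rule interiorI)
    show "open {y. support_fun K y < 1}"
      by (intro open_Collect_less continuous_support continuous_intros)
  qed (auto simp: polar_iff)
  ultimately show ?thesis by (auto simp: centered_body_def convex_body_def)
qed

end

section \<open>The bipolar theorem, and duality between boundary points and normals\<close>

context
  fixes K :: "'a::euclidean_space set"
  assumes K: "centered_body K"
begin

text \<open>This is the bipolar theorem: a hyperplane separating a point from \<open>K\<close>
  becomes, after scaling, an element of the polar that excludes the point. It identifies
  \<open>support_fun (polar_body K)\<close> with the gauge of \<open>K\<close>.\<close>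

lemma body_iff_support_polar: "x \<in> K \<longleftrightarrow> support_fun (polar_body K) x \<le> 1"
proof
  assume "x \<in> K"
  then show "support_fun (polar_body K) x \<le> 1"
    unfolding support_le_iff[OF polar_body_centered[OF K]] by (auto simp: inner_commute polar_body_def)
next
  assume le: "support_fun (polar_body K) x \<le> 1"
  show "x \<in> K"
  proof (rule ccontr)
    assume "x \<notin> K"
    then obtain a b where ab: "a \<bullet> x < b" "\<And>z. z \<in> K \<Longrightarrow> b < a \<bullet> z"
      using separating_hyperplane_closed_point[OF convex_centered_body[OF K] compact_imp_closed[OF compact_body[OF K]]]
      by blast
    \<comment> \<open>The origin lies on the side of \<open>K\<close>. Dividing by the negative
      \<open>b\<close> reverses both inequalities.\<close>
    then have "b < 0" using zero_mem[OF K] by fastforce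
    have "(1/b) *\<^sub>R a \<in> polar_body K"
      using ab(2) \<open>b < 0\<close> by (auto simp: polar_body_def inner_commute divide_simps intro: less_imp_le)
    moreover have "((1/b) *\<^sub>R a) \<bullet> x > 1"
      using ab(1) \<open>b < 0\<close> by (simp add: divide_simps)
    ultimately show False
      using le support_upper[OF polar_body_centered[OF K], of "(1/b) *\<^sub>R a" x] by simp
  qed
qed

lemma frontier_iff: "x \<in> frontier K \<longleftrightarrow> support_fun (polar_body K) x = 1"
proof -
  let ?p = "support_fun (polar_body K)"
  have "interior K = {x. ?p x < 1}"
  proof
    show "{x. ?p x < 1} \<subseteq> interior K"
    proof (rule interior_maximal)
      show "open {x. ?p x < 1}"
        by (intro open_Collect_less continuous_support[OF polar_body_centered[OF K]] continuous_intros)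
    qed (auto simp: body_iff_support_polar)
    show "interior K \<subseteq> {x. ?p x < 1}"
    proof
      fix x assume "x \<in> interior K"
      then obtain e where e: "e > 0" "cball x e \<subseteq> K" by (auto simp: mem_interior_cball)
      show "x \<in> {x. ?p x < 1}"
      proof (cases "x = 0")
        case True
        then show ?thesis by (simp add: support_zero[OF polar_body_centered[OF K]])
      next
        case False
        \<comment> \<open>This is \<open>x\<close> moved outwards along its ray by the length
          \<open>e\<close>; homogeneity of the gauge then makes \<open>?p x < 1\<close>
          strict.\<close>
        have "(1 + e / norm x) *\<^sub>R x \<in> K"
          using e False by (intro subsetD[OF e(2)]) (auto simp: dist_norm scaleR_left_distrib)
        then have "(1 + e / norm x) * ?p x \<le> 1"
          using e support_scaleR[OF polar_body_centered[OF K], of "1 + e / norm x" x] by (simp add: body_iff_support_polar)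
        moreover have "?p x < (1 + e / norm x) * ?p x"
          using e False support_pos[OF polar_body_centered[OF K], of x] by (simp add: field_simps)
        ultimately show ?thesis by simp
      qed
    qed
  qed
  then show ?thesis
    using closure_closed[OF compact_imp_closed[OF compact_body[OF K]]]
    by (auto simp: frontier_def body_iff_support_polar)
qed

text \<open>A Cauchy-Schwarz inequality for the gauge and its dual. A \<open>dual_pair\<close> is
  the case of equality with both factors equal.\<close>

lemma inner_le_support: "x \<bullet> y \<le> support_fun (polar_body K) x * support_fun K y"
proof (cases "x = 0")
  case False
  let ?p = "support_fun (polar_body K) x"
  have p: "?p > 0" using support_pos[OF polar_body_centered[OF K] False] .
  have "(1 / ?p) *\<^sub>R x \<in> K"
    using p support_scaleR[OF polar_body_centered[OF K], of "1 / ?p" x] by (simp add: body_iff_support_polar)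
  from support_upper[OF K this, of y] show ?thesis using p by (simp add: field_simps)
qed (simp add: support_zero[OF polar_body_centered[OF K]])

lemma dual_pair_exists: "\<exists>y. dual_pair K x y"
proof (cases "x = 0")
  case True
  then have "dual_pair K x 0"
    by (simp add: dual_pair_def support_zero[OF polar_body_centered[OF K]] support_zero[OF K])
  then show ?thesis ..
next
  case False
  let ?p = "support_fun (polar_body K) x"
  have p: "?p > 0" using support_pos[OF polar_body_centered[OF K] False] .
  obtain y where y: "y \<in> polar_body K" "y \<bullet> x = ?p"
    by (rule support_attained[OF polar_body_centered[OF K]])
  \<comment> \<open>At most 1 since \<open>y\<close> is in the polar, at least 1 by
    \<open>inner_le_support\<close>. Scaling \<open>y\<close> by \<open>?p\<close> then makes the
    two factors equal.\<close>
  have "support_fun K y = 1"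
    using y inner_le_support[of x y] p by (simp add: polar_iff[OF K] inner_commute)
  then have "dual_pair K x (?p *\<^sub>R y)"
    using y p by (simp add: dual_pair_def support_scaleR[OF K] inner_commute power2_eq_square)
  then show ?thesis ..
qed

lemma dual_pair_scaleR:
  assumes "0 \<le> c" "dual_pair K x y"
  shows "dual_pair K (c *\<^sub>R x) (c *\<^sub>R y)"
  using assms support_scaleR[OF polar_body_centered[OF K], of c x]
  by (simp add: dual_pair_def support_scaleR[OF K] power2_eq_square)

lemma dual_pair_eq_0_iff: "dual_pair K x y \<Longrightarrow> x = 0 \<longleftrightarrow> y = 0"
  using support_eq_0_iff[OF K, of y] support_eq_0_iff[OF polar_body_centered[OF K], of x]
  by (simp add: dual_pair_def)

text \<open>An outer unit normal \<open>u\<close> at \<open>x\<close> satisfies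
  \<open>support_fun K u = x \<bullet> u\<close>. Since the gauge of \<open>x\<close> is 1, its dual
  must have support 1, which forces the multiple \<open>u / support_fun K u\<close>.\<close>

lemma normal_iff_dual_pair:
  assumes "x \<in> frontier K"
  shows "norm u = 1 \<and> (\<forall>z\<in>K. (z - x) \<bullet> u \<le> 0) \<longleftrightarrow> (\<exists>y. dual_pair K x y \<and> u = sgn y)"
proof safe
  have p: "support_fun (polar_body K) x = 1" and "x \<noteq> 0"
    using assms by (auto simp: frontier_iff support_zero[OF polar_body_centered[OF K]])
  have xK: "x \<in> K" using p by (simp add: body_iff_support_polar)
  {
    assume u: "norm u = 1" "\<forall>z\<in>K. (z - x) \<bullet> u \<le> 0"
    then have "support_fun K u \<le> x \<bullet> u" by (simp add: support_le_iff[OF K] inner_diff_left)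
    with support_upper[OF K xK, of u] have h: "support_fun K u = x \<bullet> u" by simp
    have "u \<noteq> 0" using u by auto
    then have h0: "0 < support_fun K u" by (rule support_pos[OF K])
    have "dual_pair K x ((1 / support_fun K u) *\<^sub>R u)"
      using h h0 p by (simp add: dual_pair_def support_scaleR[OF K])
    moreover have "u = sgn ((1 / support_fun K u) *\<^sub>R u)"
      using u(1) h0 by (simp add: sgn_div_norm)
    ultimately show "\<exists>y. dual_pair K x y \<and> u = sgn y" by blast
  }
  fix y assume y: "dual_pair K x y"
  then have "y \<noteq> 0" using dual_pair_eq_0_iff \<open>x \<noteq> 0\<close> by blast
  then show "norm (sgn y) = 1" by (simp add: norm_sgn)
  fix z assume "z \<in> K"
  then have "(z - x) \<bullet> y \<le> 0"
    using y p support_upper[OF K, of z y] by (simp add: dual_pair_def inner_diff_left)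
  then show "(z - x) \<bullet> sgn y \<le> 0"
    by (simp add: sgn_div_norm mult_nonneg_nonpos)
qed

end

section \<open>Dual pairs under polarity and dilation\<close>

lemma polar_polar: "centered_body K \<Longrightarrow> polar_body (polar_body K) = K"
  using body_iff_support_polar polar_iff[OF polar_body_centered] by blast

lemma dual_pair_polar_iff:
  "centered_body K \<Longrightarrow> dual_pair (polar_body K) y x \<longleftrightarrow> dual_pair K x y"
  by (auto simp: dual_pair_def polar_polar inner_commute)

lemma polar_body_scaleR:
  assumes "0 < c"
  shows "polar_body ((\<lambda>x. c *\<^sub>R x) ` K) = (\<lambda>x. (1 / c) *\<^sub>R x) ` polar_body K"
proof (intro set_eqI iffI)
  fix y assume "y \<in> polar_body ((\<lambda>x. c *\<^sub>R x) ` K)"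
  then have "c *\<^sub>R y \<in> polar_body K" by (auto simp: polar_body_def)
  moreover have "y = (1 / c) *\<^sub>R (c *\<^sub>R y)" using assms by simp
  ultimately show "y \<in> (\<lambda>x. (1 / c) *\<^sub>R x) ` polar_body K" by blast
qed (use assms in \<open>auto simp: polar_body_def\<close>)

lemma support_fun_image_scaleR:
  assumes "centered_body K" "0 < c"
  shows "support_fun ((\<lambda>x. c *\<^sub>R x) ` K) u = c * support_fun K u"
proof -
  have "support_fun ((\<lambda>x. c *\<^sub>R x) ` K) u = support_fun K (c *\<^sub>R u)"
    by (simp add: support_fun_def image_image)
  then show ?thesis using assms by (simp add: support_scaleR)
qed

text \<open>One factor \<open>c\<close> comes from the support function, which is multiplied by
  \<open>c\<close>, the other from the gauge, which is divided by \<open>c\<close>.\<close>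

lemma dual_pair_image_scaleR:
  assumes "centered_body K" "0 < c"
  shows "dual_pair ((\<lambda>x. c *\<^sub>R x) ` K) x y \<longleftrightarrow> dual_pair K x (c\<^sup>2 *\<^sub>R y)"
  using assms
  by (auto simp: dual_pair_def polar_body_scaleR support_fun_image_scaleR polar_body_centered
      support_scaleR field_simps power2_eq_square)


section \<open>Determinants of rank-one updates\<close>

text \<open>\<open>dual_map K\<close> is the gradient of half the squared gauge \<open>support_fun (polar_body K)\<close>.\<close>

definition dual_map :: "'a::euclidean_space set \<Rightarrow> 'a \<Rightarrow> 'a" where
  "dual_map K x = (THE y. dual_pair K x y)"

definition dual_jacobian :: "(real^'n) set \<Rightarrow> real^'n \<Rightarrow> real" where
  "dual_jacobian K x = det (matrix (frechet_derivative (dual_map K) (at x)))"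

lemma linear_rank_one_update: "linear (\<lambda>v::'a::real_inner. v + (a \<bullet> v) *\<^sub>R b)"
  by (simp add: linear_iff inner_add_right scaleR_add_left scaleR_add_right)

text \<open>The matrix determinant lemma. An orthogonal change of coordinates moves \<open>a\<close>
  to a coordinate axis; the matrix then differs from the identity in one column only, and Cramer's
  rule applies.\<close>

lemma det_rank_one_update:
  fixes a b :: "real^'n"
  shows "det (matrix (\<lambda>v. v + (a \<bullet> v) *\<^sub>R b)) = 1 + a \<bullet> b"
proof (cases "a = 0")
  case True
  then show ?thesis using matrix_id_mat_1 det_I by (metis (no_types, lifting) add.right_neutral eq_id_iff inner_zero_left scaleR_zero_left)
next
  case False
  \<comment> \<open>Merely names some index.\<close>
  obtain k :: 'n where True by simp
  obtain f :: "real^'n \<Rightarrow> real^'n" where f: "orthogonal_transformation f" "f (axis k (norm a)) = a"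
  proof (rule orthogonal_transformation_exists)
    show "norm (axis k (norm a)) = norm a"
      by (simp add: norm_eq_sqrt_inner inner_axis_axis)
  qed
  let ?g = "\<lambda>v. v + (axis k (norm a) \<bullet> v) *\<^sub>R inv f b"
  have lf: "linear f" "bij f" and inner: "f u \<bullet> f v = u \<bullet> v" for u v
    using f by (auto simp: orthogonal_transformation_def orthogonal_transformation_bij)
  have finv: "f (inv f v) = v" for v using lf(2) by (simp add: bij_is_surj surj_f_inv_f)
  have lg: "linear ?g" by (rule linear_rank_one_update)
  have lh: "linear (\<lambda>v. v + (a \<bullet> v) *\<^sub>R b)"
    by (rule linear_rank_one_update)
  have "(\<lambda>v. v + (a \<bullet> v) *\<^sub>R b) \<circ> f = f \<circ> ?g"
  proof
    fix v
    have "a \<bullet> f v = axis k (norm a) \<bullet> v" using inner[of "axis k (norm a)" v] by (simp only: f(2))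
    then show "((\<lambda>v. v + (a \<bullet> v) *\<^sub>R b) \<circ> f) v = (f \<circ> ?g) v"
      by (simp add: linear_add[OF lf(1)] linear_scale[OF lf(1)] finv)
  qed
  then have "matrix (\<lambda>v. v + (a \<bullet> v) *\<^sub>R b) ** matrix f = matrix f ** matrix ?g"
    using matrix_compose[OF lf(1) lh] matrix_compose[OF lg lf(1)] by (simp only:)
  then have "det (matrix (\<lambda>v. v + (a \<bullet> v) *\<^sub>R b)) * det (matrix f) = det (matrix f) * det (matrix ?g)"
    unfolding det_mul[symmetric] by (rule arg_cong)
  moreover have "det (matrix f) \<noteq> 0"
    using lf det_nz_iff_inj[OF lf(1)] by (simp add: bij_is_inj)
  moreover have "det (matrix ?g) = 1 + a \<bullet> b"
  proof -
    let ?c = "norm a *\<^sub>R inv f b"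
    have "matrix ?g = (\<chi> i j. if j = k then (mat 1 *v (axis k 1 + ?c)) $ i else mat 1 $ i $ j)"
      by (simp add: matrix_def vec_eq_iff inner_axis_axis) (simp add: axis_def mat_def)
    then have "det (matrix ?g) = (axis k 1 + ?c) $ k"
      using cramer_lemma[of k "mat 1" "axis k 1 + ?c"] by (simp add: det_I)
    also have "\<dots> = 1 + axis k (norm a) \<bullet> inv f b"
      by (simp add: inner_axis inner_commute[of "axis k (norm a)"])
    also have "axis k (norm a) \<bullet> inv f b = a \<bullet> b"
      using inner[of "axis k (norm a)" "inv f b"] f(2) by (simp add: finv)
    finally show ?thesis .
  qed
  ultimately show ?thesis by simp
qed

lemma det_matrix_scaleR:
  fixes f :: "real^'n \<Rightarrow> real^'n"
  shows "det (matrix (\<lambda>v. c *\<^sub>R f v)) = c ^ CARD('n) * det (matrix f)"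
proof -
  have "matrix (\<lambda>v. c *\<^sub>R f v) = mat c ** matrix f"
    by (simp add: matrix_def matrix_matrix_mult_def mat_def vec_eq_iff if_distrib[of "\<lambda>x. x * _"] cong: if_cong)
  then show ?thesis by (simp add: det_mul det_diagonal mat_def)
qed

lemma det_matrix_compose:
  fixes f g :: "real^'n \<Rightarrow> real^'n"
  assumes "linear f" "linear g"
  shows "det (matrix (\<lambda>v. f (g v))) = det (matrix f) * det (matrix g)"
  using matrix_compose[OF assms(2,1)] by (simp add: o_def det_mul)

text \<open>With \<open>P v = v - (v \<bullet> \<nu>) \<nu>\<close> the projection along \<open>\<nu>\<close>, the left-hand operator is a
  composition \<open>A \<circ> (v \<mapsto> P v + (v \<bullet> \<nu>) x) \<circ> S\<close> where \<open>S\<close> is a shear in direction \<open>\<nu>\<close>.\<close>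

lemma det_tangential:
  fixes A :: "real^'n \<Rightarrow> real^'n" and \<nu> x :: "real^'n"
  assumes A: "linear A" and \<nu>: "norm \<nu> = 1" and Ax: "A x = r *\<^sub>R \<nu>" and x: "r * (x \<bullet> \<nu>) = 1"
  shows "det (matrix (\<lambda>v. let w = A (v - (v \<bullet> \<nu>) *\<^sub>R \<nu>) in
             (1 / r) *\<^sub>R (w - (w \<bullet> \<nu>) *\<^sub>R \<nu>) + (v \<bullet> \<nu>) *\<^sub>R \<nu>)) * r ^ (CARD('n) + 1) = det (matrix A)"
proof -
  have r: "r \<noteq> 0" using x by auto
  define d where "d = (\<lambda>v. A (v - (v \<bullet> \<nu>) *\<^sub>R \<nu>) \<bullet> \<nu>)"
  have \<nu>1: "\<nu> \<bullet> \<nu> = 1" using \<nu> by (simp add: dot_square_norm)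
  define b where "b = adjoint A \<nu> - (adjoint A \<nu> \<bullet> \<nu>) *\<^sub>R \<nu>"
  have b: "d v = b \<bullet> v" for v
    unfolding d_def b_def adjoint_works[OF A, symmetric]
    by (simp add: inner_diff_left inner_diff_right inner_commute)
  have b\<nu>: "b \<bullet> \<nu> = 0" by (simp add: b_def inner_diff_left \<nu>1)
  define C where "C = (\<lambda>v. v + (\<nu> \<bullet> v) *\<^sub>R (x - \<nu>))"
  \<comment> \<open>\<open>C\<close> maps \<open>\<nu>\<close> to \<open>x\<close>, and
    \<open>A x = r *\<^sub>R \<nu>\<close>, so the added multiple of \<open>\<nu>\<close>
    contributes exactly \<open>- d v *\<^sub>R \<nu>\<close> to \<open>A (C (S v))\<close>: it
    removes the normal component of the tangential image.\<close>
  define S where "S = (\<lambda>v. v + (b \<bullet> v) *\<^sub>R ((- 1 / r) *\<^sub>R \<nu>))"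
  have lin: "linear C" "linear S"
    unfolding C_def S_def by (rule linear_rank_one_update)+
  let ?B = "\<lambda>v. let w = A (v - (v \<bullet> \<nu>) *\<^sub>R \<nu>) in
             (1 / r) *\<^sub>R (w - (w \<bullet> \<nu>) *\<^sub>R \<nu>) + (v \<bullet> \<nu>) *\<^sub>R \<nu>"
  have "?B v = (1 / r) *\<^sub>R A (C (S v))" for v
  proof -
    let ?w = "A (v - (v \<bullet> \<nu>) *\<^sub>R \<nu>)"
    have "C (S v) = (v - (v \<bullet> \<nu>) *\<^sub>R \<nu>) + (v \<bullet> \<nu> - (b \<bullet> v) / r) *\<^sub>R x"
      using b\<nu> unfolding C_def S_def
      by (simp add: inner_add_right \<nu>1 inner_commute algebra_simps)
    then have "A (C (S v)) = ?w + (v \<bullet> \<nu> - (b \<bullet> v) / r) *\<^sub>R (r *\<^sub>R \<nu>)"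
      using A by (simp add: linear_add linear_scale Ax)
    also have "\<dots> = ?w - (?w \<bullet> \<nu>) *\<^sub>R \<nu> + r *\<^sub>R (v \<bullet> \<nu>) *\<^sub>R \<nu>"
      using r by (simp add: b[symmetric] d_def algebra_simps)
    finally show ?thesis using r by (simp add: Let_def scaleR_add_right)
  qed
  then have "det (matrix ?B) = (1 / r) ^ CARD('n) * det (matrix (\<lambda>v. A (C (S v))))"
    by (simp only: det_matrix_scaleR)
  also have "det (matrix (\<lambda>v. A (C (S v)))) = det (matrix A) * (det (matrix C) * det (matrix S))"
    using det_matrix_compose[OF A linear_compose[OF lin(2,1)]] det_matrix_compose[OF lin] by (simp add: o_def)
  also have "det (matrix C) = x \<bullet> \<nu>"
    unfolding C_def det_rank_one_update by (simp add: inner_diff_right \<nu>1 inner_commute)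
  also have "det (matrix S) = 1"
    unfolding S_def det_rank_one_update by (simp add: b\<nu>)
  \<comment> \<open>The power \<open>n\<close> of \<open>r\<close> stems from the scalar
    \<open>1 / r\<close>, the extra one from
    \<open>det (matrix C) = x \<bullet> \<nu> = 1 / r\<close>.\<close>
  finally show ?thesis using r x by (simp add: power_divide field_simps)
qed


section \<open>The duality map and the Gauss curvature\<close>

text \<open>For a convex function, uniqueness of the subgradient expresses differentiability.
  Phrased through pairs it suits polarity, which just swaps the two entries.\<close>

definition smooth_body :: "'a::euclidean_space set \<Rightarrow> bool" where
  "smooth_body K \<longleftrightarrow> centered_body K \<and> (\<forall>x. \<exists>!y. dual_pair K x y)"

lemma smooth_body_centered: "smooth_body K \<Longrightarrow> centered_body K"
  by (simp add: smooth_body_def)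

lemma dual_pair_dual_map: "smooth_body K \<Longrightarrow> dual_pair K x (dual_map K x)"
  unfolding smooth_body_def dual_map_def by (metis theI')

lemma dual_map_unique: "smooth_body K \<Longrightarrow> dual_pair K x y \<Longrightarrow> dual_map K x = y"
  using dual_pair_dual_map unfolding smooth_body_def by blast

lemma dual_map_eq_0_iff: "smooth_body K \<Longrightarrow> dual_map K x = 0 \<longleftrightarrow> x = 0"
  using dual_pair_eq_0_iff[OF smooth_body_centered dual_pair_dual_map] by blast

lemma dual_map_scaleR:
  assumes "smooth_body K" "0 \<le> c"
  shows "dual_map K (c *\<^sub>R x) = c *\<^sub>R dual_map K x"
  using assms by (intro dual_map_unique dual_pair_scaleR dual_pair_dual_map smooth_body_centered)

lemma inner_dual_map: "smooth_body K \<Longrightarrow> x \<bullet> dual_map K x = (support_fun (polar_body K) x)\<^sup>2"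
  and support_dual_map: "smooth_body K \<Longrightarrow> support_fun K (dual_map K x) = support_fun (polar_body K) x"
  using dual_pair_dual_map[of K x] by (auto simp: dual_pair_def)

lemma outer_normal_dual_map:
  assumes "smooth_body K" "x \<in> frontier K"
  shows "outer_normal K x = sgn (dual_map K x)"
proof -
  have "(\<exists>y. dual_pair K x y \<and> u = sgn y) \<longleftrightarrow> u = sgn (dual_map K x)" for u
    using assms dual_pair_dual_map dual_map_unique by blast
  then show ?thesis
    unfolding outer_normal_def
    using normal_iff_dual_pair[OF smooth_body_centered[OF assms(1)] assms(2)] by simp
qed

text \<open>A convex function whose subgradient is continuous at \<open>x\<close> is differentiable
  there: by the subgradient inequalities at \<open>x\<close> and at \<open>w\<close>, the
  linearisation error lies between 0 and \<open>(N w - N x) \<bullet> (w - x)\<close>.\<close>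

lemma gauge_has_derivative:
  assumes K: "smooth_body K" and x: "x \<noteq> 0" and cont: "continuous (at x) (dual_map K)"
  shows "(support_fun (polar_body K) has_derivative
           (\<lambda>v. (dual_map K x /\<^sub>R support_fun (polar_body K) x) \<bullet> v)) (at x)"
proof -
  let ?p = "support_fun (polar_body K)"
  define N where "N z = dual_map K z /\<^sub>R ?p z" for z
  note cb = smooth_body_centered[OF K]
  note polar = polar_body_centered[OF cb]
  have p0: "0 < ?p z" if "z \<noteq> 0" for z using support_pos[OF polar that] .
  have Nz: "N z \<bullet> z = ?p z" if "z \<noteq> 0" for z
    using p0[OF that] inner_dual_map[OF K, of z]
    by (simp add: N_def inner_commute power2_eq_square)
  have Nle: "N z \<bullet> w \<le> ?p w" if "z \<noteq> 0" for z w
  proof (rule support_upper[OF polar])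
    show "N z \<in> polar_body K"
      using p0[OF that] support_scaleR[OF cb, of "inverse (?p z)" "dual_map K z"]
      by (simp add: polar_iff[OF cb] N_def support_dual_map[OF K])
  qed
  have "continuous (at x) ?p"
    using continuous_support[OF polar, of UNIV] by (simp add: continuous_on_eq_continuous_at)
  then have contN: "continuous (at x) N"
    unfolding N_def using cont p0[OF x] by (intro continuous_intros) auto
  show ?thesis
    unfolding has_derivative_at_alt N_def[symmetric]
  proof (intro conjI allI impI)
    show "bounded_linear ((\<bullet>) (N x))" by (rule bounded_linear_inner_right)
    fix e :: real assume "0 < e"
    then obtain d where d: "d > 0" "\<And>w. dist w x < d \<Longrightarrow> dist (N w) (N x) < e"
      using contN unfolding continuous_at_eps_delta by blast
    show "\<exists>d>0. \<forall>w. norm (w - x) < d \<longrightarrow> norm (?p w - ?p x - N x \<bullet> (w - x)) \<le> e * norm (w - x)"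
    proof (intro exI[of _ "min d (norm x)"] conjI allI impI)
      show "0 < min d (norm x)" using d x by simp
      fix w assume w: "norm (w - x) < min d (norm x)"
      then have w0: "w \<noteq> 0" by auto
      have "?p w - ?p x - N x \<bullet> (w - x) \<le> (N w - N x) \<bullet> (w - x)"
        using Nz[OF w0] Nle[OF w0, of x] by (simp add: inner_diff_left inner_diff_right)
      also have "\<dots> \<le> norm (N w - N x) * norm (w - x)" by (rule norm_cauchy_schwarz)
      also have "\<dots> \<le> e * norm (w - x)"
        using d(2)[of w] w by (intro mult_right_mono) (auto simp: dist_norm)
      finally have "?p w - ?p x - N x \<bullet> (w - x) \<le> e * norm (w - x)" .
      moreover have "0 \<le> ?p w - ?p x - N x \<bullet> (w - x)"
        using Nz[OF x] Nle[OF x, of w] by (simp add: inner_diff_right)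
      ultimately show "norm (?p w - ?p x - N x \<bullet> (w - x)) \<le> e * norm (w - x)" by simp
    qed
  qed
qed

lemma has_derivative_sgn:
  fixes y :: "'a::real_inner"
  assumes "y \<noteq> 0"
  shows "(sgn has_derivative (\<lambda>v. (1 / norm y) *\<^sub>R (v - (v \<bullet> sgn y) *\<^sub>R sgn y))) (at y)"
proof -
  have "((\<lambda>y. inverse (norm y) *\<^sub>R y) has_derivative
     (\<lambda>v. (1 / norm y) *\<^sub>R (v - (v \<bullet> sgn y) *\<^sub>R sgn y))) (at y)"
    using assms
    by (auto intro!: derivative_eq_intros has_derivative_norm simp: fun_eq_iff sgn_div_norm algebra_simps inner_commute divide_inverse)
  then show ?thesis by (simp add: sgn_div_norm[abs_def])
qed

text \<open>Euler's identity for degree one: differentiate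
  \<open>dual_map K (t *\<^sub>R x) = t *\<^sub>R dual_map K x\<close> at
  \<open>t = 1\<close>.\<close>

lemma dual_map_euler:
  assumes K: "smooth_body K" and der: "(dual_map K has_derivative A) (at x)"
  shows "A x = dual_map K x"
proof -
  have "((\<lambda>t. dual_map K (t *\<^sub>R x)) has_vector_derivative A x) (at 1)"
    unfolding has_vector_derivative_def
  proof -
    have "((\<lambda>t. t *\<^sub>R x) has_derivative (\<lambda>t. t *\<^sub>R x)) (at (1::real))"
      by (auto intro!: derivative_eq_intros)
    then show "((\<lambda>t. dual_map K (t *\<^sub>R x)) has_derivative (\<lambda>t. t *\<^sub>R A x)) (at 1)"
      using has_derivative_compose[of "\<lambda>t::real. t *\<^sub>R x" "\<lambda>t. t *\<^sub>R x" 1 UNIV "dual_map K" A] der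
        linear_scale[OF has_derivative_linear[OF der]] by simp
  qed
  moreover have "((\<lambda>t. dual_map K (t *\<^sub>R x)) has_vector_derivative dual_map K x) (at 1)"
  proof (rule has_vector_derivative_transform_within_open)
    show "((\<lambda>t. t *\<^sub>R dual_map K x) has_vector_derivative dual_map K x) (at 1)"
      by (auto intro!: derivative_eq_intros)
    show "open {0::real<..}" "1 \<in> {0::real<..}" by auto
  qed (auto simp: dual_map_scaleR[OF K])
  ultimately show ?thesis by (rule vector_derivative_unique_at)
qed

text \<open>The Gauss map is \<open>sgn\<close> after \<open>dual_map K\<close>, so on tangent
  vectors its derivative is \<open>1 / r\<close> times the tangential part of \<open>A\<close>;
  Euler's identity supplies the value of \<open>A\<close> in the remaining direction
  \<open>x\<close>, and \<open>det_tangential\<close> combines both.\<close>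

proposition gauss_curvature_dual_map:
  fixes K :: "(real^'n) set"
  assumes K: "smooth_body K" and x: "x \<in> frontier K" and der: "(dual_map K has_derivative A) (at x)"
  shows "gauss_curvature K x * norm (dual_map K x) ^ (CARD('n) + 1) = det (matrix A)"
proof -
  note cb = smooth_body_centered[OF K]
  let ?p = "support_fun (polar_body K)"
  define \<nu> where "\<nu> = sgn (dual_map K x)"
  define r where "r = norm (dual_map K x)"
  have px: "?p x = 1" using x by (simp add: frontier_iff[OF cb])
  then have x0: "x \<noteq> 0" using support_zero[OF polar_body_centered[OF cb]] by auto
  then have \<Psi>0: "dual_map K x \<noteq> 0" by (simp add: dual_map_eq_0_iff[OF K])
  then have \<Psi>: "dual_map K x = r *\<^sub>R \<nu>" and "norm \<nu> = 1" and r0: "r > 0"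
    by (simp_all add: r_def \<nu>_def sgn_div_norm)
  have x\<nu>: "r * (x \<bullet> \<nu>) = 1" using inner_dual_map[OF K, of x] by (simp add: px \<Psi>)
  define E where "E v = (1 / r) *\<^sub>R (A v - (A v \<bullet> \<nu>) *\<^sub>R \<nu>)" for v
  have "((\<lambda>y. sgn (dual_map K y)) has_derivative E) (at x within frontier K)"
    using has_derivative_compose[OF has_derivative_at_withinI[OF der] has_derivative_sgn[OF \<Psi>0]]
    by (simp add: E_def[abs_def] r_def \<nu>_def)
  then have E: "(outer_normal K has_derivative E) (at x within frontier K)"
    by (rule has_derivative_transform[OF x, rotated]) (simp add: outer_normal_dual_map[OF K])
  define W where "W = frechet_derivative (outer_normal K) (at x within frontier K)"
  have W: "(outer_normal K has_derivative W) (at x within frontier K)"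
    unfolding W_def using E differentiableI frechet_derivative_works by blast
  have WE: "W v = E v" if v: "v \<bullet> \<nu> = 0" for v
  proof -
    \<comment> \<open>The tangent line projected radially to the boundary. The gauge has derivative
      0 in a tangent direction, so this curve has velocity \<open>v\<close> at 0, and any two
      derivatives within the boundary agree on \<open>v\<close>.\<close>
    define \<gamma> where "\<gamma> t = (x + t *\<^sub>R v) /\<^sub>R ?p (x + t *\<^sub>R v)" for t
    have ne: "x + t *\<^sub>R v \<noteq> 0" for t
    proof
      assume "x + t *\<^sub>R v = 0"
      then have "(x + t *\<^sub>R v) \<bullet> \<nu> = 0" by simp
      then show False using v x\<nu> by (simp add: inner_add_left)
    qed
    have \<gamma>fr: "\<gamma> t \<in> frontier K" for t
      using support_pos[OF polar_body_centered[OF cb] ne[of t]]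
        support_scaleR[OF polar_body_centered[OF cb], of "inverse (?p (x + t *\<^sub>R v))" "x + t *\<^sub>R v"]
      by (simp add: frontier_iff[OF cb] \<gamma>_def)
    have dp: "(?p has_derivative (\<lambda>v. dual_map K x \<bullet> v)) (at (x + 0 *\<^sub>R v))"
      using gauge_has_derivative[OF K x0 has_derivative_continuous[OF der]] px by simp
    have "((\<lambda>t. ?p (x + t *\<^sub>R v)) has_derivative (\<lambda>t. dual_map K x \<bullet> (t *\<^sub>R v))) (at 0)"
      by (rule has_derivative_compose[where g = ?p and f = "\<lambda>t. x + t *\<^sub>R v", OF _ dp])
        (auto intro!: derivative_eq_intros)
    then have dp': "((\<lambda>t. ?p (x + t *\<^sub>R v)) has_derivative (\<lambda>t. 0)) (at 0)"
      using v by (simp add: \<Psi> inner_commute)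
    have d\<gamma>: "(\<gamma> has_derivative (\<lambda>t. t *\<^sub>R v)) (at 0)"
      unfolding \<gamma>_def[abs_def]
      by (rule derivative_eq_intros dp' refl | simp add: px)+
    have \<gamma>0: "\<gamma> 0 = x" by (simp add: \<gamma>_def px)
    have "((outer_normal K \<circ> \<gamma>) has_vector_derivative D v) (at 0)"
      if D: "(outer_normal K has_derivative D) (at x within frontier K)" for D
    proof -
      have "(outer_normal K has_derivative D) (at (\<gamma> 0) within range \<gamma>)"
        unfolding \<gamma>0 by (rule has_derivative_subset[OF D]) (use \<gamma>fr in auto)
      from diff_chain_within[OF d\<gamma> this]
      show ?thesis
        unfolding has_vector_derivative_def
        using linear_scale[OF has_derivative_linear[OF D]] by (simp add: o_def)
    qed
    from vector_derivative_unique_at[OF this[OF W] this[OF E]] show ?thesis .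
  qed
  have "W (v - (v \<bullet> \<nu>) *\<^sub>R \<nu>) = E (v - (v \<bullet> \<nu>) *\<^sub>R \<nu>)" for v
    using \<open>norm \<nu> = 1\<close> by (intro WE) (simp add: inner_diff_left dot_square_norm)
  then have "gauss_curvature K x = det (matrix (\<lambda>v. let w = A (v - (v \<bullet> \<nu>) *\<^sub>R \<nu>) in
             (1 / r) *\<^sub>R (w - (w \<bullet> \<nu>) *\<^sub>R \<nu>) + (v \<bullet> \<nu>) *\<^sub>R \<nu>))"
    by (simp add: gauss_curvature_def outer_normal_dual_map[OF K x] \<nu>_def[symmetric] W_def[symmetric] E_def Let_def)
  then show ?thesis
    using det_tangential[OF has_derivative_linear[OF der] \<open>norm \<nu> = 1\<close> _ x\<nu>]
      dual_map_euler[OF K der, unfolded \<Psi>] by (simp add: r_def)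
qed


section \<open>Bodies of class C2\<close>

text \<open>A dual of a boundary point \<open>z\<close> is normal to the boundary, hence a multiple
  of the gradient \<open>G z\<close>; the normalisation \<open>z \<bullet> y = 1\<close> fixes the
  multiple as \<open>1 / (G z \<bullet> z)\<close>.\<close>

lemma C2_boundary_local_dual_map:
  fixes K :: "(real^'n) set"
  assumes K: "centered_body K" and C2: "C2_boundary K" and x: "x \<in> frontier K"
  obtains U N where "open U" "x \<in> U" "N differentiable at x"
    "\<And>z y. z \<in> frontier K \<inter> U \<Longrightarrow> dual_pair K z y \<Longrightarrow> y = N z"
proof -
  obtain U g G where U: "open U" "x \<in> U" and gG: "C2_fun_on g U G" and G0: "\<And>y. y \<in> U \<Longrightarrow> G y \<noteq> 0"
    and fr: "frontier K \<inter> U = {y\<in>U. g y = 0}"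
    using C2 x unfolding C2_boundary_def by meson
  obtain H :: "real^'n \<Rightarrow> real^'n^'n"
    where dg: "\<And>x. x \<in> U \<Longrightarrow> (g has_derivative (\<lambda>v. G x \<bullet> v)) (at x)"
      and dG: "\<And>x. x \<in> U \<Longrightarrow> (G has_derivative (\<lambda>v. H x *v v)) (at x)"
    using gG unfolding C2_fun_on_def by blast
  have contg: "continuous_on U g"
    by (intro continuous_at_imp_continuous_on ballI has_derivative_continuous[OF dg])
  define N where "N z = (1 / (G z \<bullet> z)) *\<^sub>R G z" for z
  have N: "G z \<bullet> z \<noteq> 0 \<and> y = N z" if z: "z \<in> frontier K \<inter> U" and y: "dual_pair K z y" for z y
  proof -
    define a where "a = G z"
    define v where "v = y - ((y \<bullet> a) / (a \<bullet> a)) *\<^sub>R a"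
    have a0: "a \<noteq> 0" using G0 z by (simp add: a_def)
    then have aa: "0 < a \<bullet> a" by simp
    have pz: "support_fun (polar_body K) z = 1" using z by (simp add: frontier_iff[OF K])
    have zy: "z \<bullet> y = 1" and hy: "support_fun K y = 1" using y pz by (auto simp: dual_pair_def)
    have av: "a \<bullet> v = 0" using a0 by (simp add: v_def inner_diff_right inner_commute)
    \<comment> \<open>Otherwise the tangent direction \<open>v\<close> increases the product with
      \<open>y\<close>. Tilting \<open>v\<close> by multiples of \<open>a\<close> between
      \<open>- e\<close> and \<open>e\<close> makes \<open>g\<close> change sign, so a boundary
      point lies in between; its product with \<open>y\<close> exceeds
      \<open>support_fun K y = 1\<close>.\<close>
    have "v = 0"
    proof (rule ccontr)
      assume "v \<noteq> 0"
      then have vv: "0 < v \<bullet> v" by simp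
      have vy: "v \<bullet> y = v \<bullet> v"
      proof -
        have "y = v + ((y \<bullet> a) / (a \<bullet> a)) *\<^sub>R a" by (simp add: v_def)
        then have "v \<bullet> y = v \<bullet> (v + ((y \<bullet> a) / (a \<bullet> a)) *\<^sub>R a)" by simp
        then show ?thesis using av by (simp add: inner_add_right inner_commute)
      qed
      \<comment> \<open>So small that the tilt costs less than the gain
        \<open>v \<bullet> v\<close>; the summand 1 avoids a zero denominator.\<close>
      define e where "e = (v \<bullet> v) / (2 * (\<bar>a \<bullet> y\<bar> + 1))"
      have e: "e > 0" using vv by (simp add: e_def divide_pos_pos)
      have eay: "e * \<bar>a \<bullet> y\<bar> < v \<bullet> v"
      proof -
        have "e * \<bar>a \<bullet> y\<bar> \<le> e * (\<bar>a \<bullet> y\<bar> + 1)" using e by simp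
        also have "\<dots> = (v \<bullet> v) / 2" by (simp add: e_def field_simps)
        also have "\<dots> < v \<bullet> v" using vv by simp
        finally show ?thesis .
      qed
      have line: "((\<lambda>t. g (z + t *\<^sub>R w)) has_real_derivative a \<bullet> w) (at 0)" for w
      proof -
        have "(g has_derivative (\<lambda>v. a \<bullet> v)) (at (z + 0 *\<^sub>R w))"
          using dg[of z] z by (simp add: a_def)
        from has_derivative_compose[where g = g and f = "\<lambda>t. z + t *\<^sub>R w" and f' = "\<lambda>t. t *\<^sub>R w", OF _ this]
        have "((\<lambda>t. g (z + t *\<^sub>R w)) has_derivative (\<lambda>t. a \<bullet> (t *\<^sub>R w))) (at 0)"
          by this (auto intro!: derivative_eq_intros)
        then show ?thesis
          by (rule has_derivative_imp_has_field_derivative) simp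
      qed
      have g0: "g z = 0" using z fr by blast
      have "0 < a \<bullet> (v + e *\<^sub>R a)" "a \<bullet> (v + (- e) *\<^sub>R a) < 0"
        using av aa e by (simp_all add: inner_add_right inner_diff_right mult_pos_pos)
      with DERIV_pos_inc_right[OF line, of "v + e *\<^sub>R a"] DERIV_neg_dec_right[OF line, of "v + (- e) *\<^sub>R a"]
      obtain d1 d2 where d: "d1 > 0" "\<And>h. 0 < h \<Longrightarrow> h < d1 \<Longrightarrow> 0 < g (z + h *\<^sub>R (v + e *\<^sub>R a))"
        "d2 > 0" "\<And>h. 0 < h \<Longrightarrow> h < d2 \<Longrightarrow> g (z + h *\<^sub>R (v + (- e) *\<^sub>R a)) < 0"
        unfolding scaleR_zero_left add_0_right add_0_left g0 by blast
      obtain \<delta> where \<delta>: "\<delta> > 0" "ball z \<delta> \<subseteq> U" using U(1) z open_contains_ball by blast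
      let ?M = "norm v + e * norm a"
      have M: "?M \<ge> 0" using e by simp
      define m where "m = min (min d1 d2) (\<delta> / (?M + 1))"
      have m: "0 < m" "m \<le> d1" "m \<le> d2" "m \<le> \<delta> / (?M + 1)"
        using d \<delta> M by (simp_all add: m_def divide_pos_pos)
      define t where "t = m / 2"
      have t: "0 < t" "t < d1" "t < d2" "t < \<delta> / (?M + 1)"
        using m unfolding t_def by linarith+
      have inU: "z + t *\<^sub>R (v + s *\<^sub>R a) \<in> U" if s: "s \<in> {-e..e}" for s
      proof -
        have "norm (v + s *\<^sub>R a) \<le> ?M"
          using s by (intro norm_triangle_le add_left_mono) (auto intro!: mult_right_mono)
        then have "t * norm (v + s *\<^sub>R a) \<le> t * (?M + 1)" using t(1) by (intro mult_left_mono) auto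
        also have "\<dots> < \<delta>" using t(4) M by (simp add: pos_less_divide_eq)
        finally show ?thesis using t(1) by (intro subsetD[OF \<delta>(2)]) (simp add: dist_norm)
      qed
      have "continuous_on {-e..e} (\<lambda>s. g (z + t *\<^sub>R (v + s *\<^sub>R a)))"
        by (rule continuous_on_compose2[OF contg]) (auto intro!: continuous_intros inU)
      then obtain s where s: "-e \<le> s" "s \<le> e" "g (z + t *\<^sub>R (v + s *\<^sub>R a)) = 0"
        using IVT'[of "\<lambda>s. g (z + t *\<^sub>R (v + s *\<^sub>R a))" "-e" 0 e]
          less_imp_le[OF d(2)[OF t(1,2)]] less_imp_le[OF d(4)[OF t(1,3)]] e by auto
      then have "z + t *\<^sub>R (v + s *\<^sub>R a) \<in> frontier K" using inU[of s] fr by auto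
      then have "z + t *\<^sub>R (v + s *\<^sub>R a) \<in> K"
        by (simp add: body_iff_support_polar[OF K] frontier_iff[OF K])
      from support_upper[OF K this, of y]
      have "t * (v \<bullet> v + s * (a \<bullet> y)) \<le> 0" by (simp add: hy zy inner_add_left vy)
      moreover have "\<bar>s * (a \<bullet> y)\<bar> \<le> e * \<bar>a \<bullet> y\<bar>"
        using s by (simp add: abs_mult mult_right_mono)
      ultimately have "0 < v \<bullet> v + s * (a \<bullet> y)" using eay by linarith
      with t(1) have "0 < t * (v \<bullet> v + s * (a \<bullet> y))" by simp
      with \<open>t * (v \<bullet> v + s * (a \<bullet> y)) \<le> 0\<close> show False by simp
    qed
    define c where "c = (y \<bullet> a) / (a \<bullet> a)"
    from \<open>v = 0\<close> have yc: "y = c *\<^sub>R a" by (simp add: v_def c_def)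
    have "c * (a \<bullet> z) = 1" using zy by (simp add: yc inner_commute)
    then have "a \<bullet> z \<noteq> 0" "c = 1 / (a \<bullet> z)" by (auto simp: eq_divide_eq)
    with yc show ?thesis by (simp add: N_def a_def[symmetric])
  qed
  obtain y where "dual_pair K x y" using dual_pair_exists[OF K] by blast
  then have "G x \<bullet> x \<noteq> 0" using N x U by blast
  then have "N differentiable at x"
    unfolding N_def[abs_def] using differentiableI[OF dG[OF U(2)]]
    by (intro differentiable_scaleR differentiable_divide differentiable_inner differentiable_const) auto
  with U N that show ?thesis by blast
qed

text \<open>Smoothness with positive curvature, in a form that is invariant under polarity.\<close>

definition regular_body :: "(real^'n) set \<Rightarrow> bool" where
  "regular_body K \<longleftrightarrow> smooth_body K \<and>
     (\<forall>x. x \<noteq> 0 \<longrightarrow> dual_map K differentiable at x \<and> 0 < dual_jacobian K x)"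

lemma dual_jacobian_eq:
  "(dual_map K has_derivative A) (at x) \<Longrightarrow> dual_jacobian K x = det (matrix A)"
  using frechet_derivative_at[of "dual_map K" A x] by (simp add: dual_jacobian_def)

text \<open>The derivative of a map that is homogeneous of degree one is homogeneous of degree
  zero.\<close>

lemma has_derivative_dual_map_scaleR:
  assumes K: "smooth_body K" and c: "0 < c" and der: "(dual_map K has_derivative A) (at x)"
  shows "(dual_map K has_derivative A) (at (c *\<^sub>R x))"
proof -
  have "(dual_map K has_derivative A) (at ((1/c) *\<^sub>R (c *\<^sub>R x)))" using der c by simp
  from has_derivative_compose[where g = "dual_map K" and f = "\<lambda>w. (1/c) *\<^sub>R w" and f' = "\<lambda>w. (1/c) *\<^sub>R w", OF _ this]
  have "((\<lambda>w. dual_map K ((1/c) *\<^sub>R w)) has_derivative (\<lambda>w. A ((1/c) *\<^sub>R w))) (at (c *\<^sub>R x))"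
    by this (auto intro!: derivative_eq_intros)
  then have "((\<lambda>w. c *\<^sub>R dual_map K ((1/c) *\<^sub>R w)) has_derivative (\<lambda>w. c *\<^sub>R A ((1/c) *\<^sub>R w))) (at (c *\<^sub>R x))"
    by (rule has_derivative_scaleR_right)
  then show ?thesis
    using c linear_scale[OF has_derivative_linear[OF der]] by (simp add: dual_map_scaleR[OF K])
qed

text \<open>The local formula for duals holds on a hypersurface only. Homogeneity extends it to open
  sets, and also carries differentiability and the positive Jacobian from the boundary to all
  nonzero points.\<close>

proposition C2_plus_regular:
  fixes K :: "(real^'n) set"
  assumes "K \<in> C2_plus"
  shows "regular_body K"
proof -
  have K: "centered_body K" and C2: "C2_boundary K"
    and curv: "\<And>x. x \<in> frontier K \<Longrightarrow> 0 < gauss_curvature K x"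
    using assms by (auto simp: C2_plus_def centered_body_def)
  note polar = polar_body_centered[OF K]
  let ?p = "support_fun (polar_body K)"
  have normalize: "(1 / ?p z) *\<^sub>R z \<in> frontier K" "0 < ?p z" if "z \<noteq> 0" for z
    using support_pos[OF polar that] support_scaleR[OF polar, of "1 / ?p z" z]
    by (auto simp: frontier_iff[OF K])
  have "y = y'" if yy': "dual_pair K x y" "dual_pair K x y'" for x y y'
  proof (cases "x = 0")
    case True
    then show ?thesis using yy' dual_pair_eq_0_iff[OF K] by blast
  next
    case False
    let ?c = "1 / ?p x"
    obtain U N where U: "?c *\<^sub>R x \<in> U"
      "\<And>z y. z \<in> frontier K \<inter> U \<Longrightarrow> dual_pair K z y \<Longrightarrow> y = N z"
      using C2_boundary_local_dual_map[OF K C2 normalize(1)[OF False]] by metis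
    have "?c *\<^sub>R y = ?c *\<^sub>R y'"
      using U normalize[OF False] yy' dual_pair_scaleR[OF K, of ?c x] by (metis IntI less_imp_le zero_less_divide_1_iff)
    then show ?thesis using normalize(2)[OF False] by simp
  qed
  then have smooth: "smooth_body K"
    using K dual_pair_exists[OF K] unfolding smooth_body_def by blast
  have frontier: "dual_map K differentiable at x" if x: "x \<in> frontier K" for x
  proof -
    obtain U N where U: "open U" "x \<in> U" and N: "N differentiable at x"
      "\<And>z y. z \<in> frontier K \<inter> U \<Longrightarrow> dual_pair K z y \<Longrightarrow> y = N z"
      using C2_boundary_local_dual_map[OF K C2 x] by metis
    have px: "?p x = 1" using x by (simp add: frontier_iff[OF K])
    then have x0: "x \<noteq> 0" using support_zero[OF polar] by auto
    \<comment> \<open>The radial projection to the boundary, through which \<open>N\<close> is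
      evaluated at points near \<open>x\<close>.\<close>
    define \<rho> where "\<rho> w = (1 / ?p w) *\<^sub>R w" for w
    have contp: "continuous_on S ?p" for S by (rule continuous_support[OF polar])
    have cont\<rho>: "continuous_on (- {0}) \<rho>"
      unfolding \<rho>_def using normalize(2) by (intro continuous_intros contp) fastforce
    define V where "V = - {0} \<inter> \<rho> -` U"
    have V: "open V" "x \<in> V"
      using continuous_open_preimage[OF cont\<rho>] U x0 px by (auto simp: V_def \<rho>_def)
    have eq: "dual_map K w = ?p w *\<^sub>R N (\<rho> w)" if "w \<in> V" for w
    proof -
      have w0: "w \<noteq> 0" and "\<rho> w \<in> frontier K \<inter> U"
        using that normalize(1)[of w] by (auto simp: V_def \<rho>_def)
      then have "dual_map K (\<rho> w) = N (\<rho> w)" using N(2) dual_pair_dual_map[OF smooth] by blast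
      moreover have "dual_map K w = ?p w *\<^sub>R dual_map K (\<rho> w)"
        using normalize(2)[OF w0] by (simp add: \<rho>_def dual_map_scaleR[OF smooth])
      ultimately show ?thesis by simp
    qed
    have \<rho>x: "\<rho> x = x" by (simp add: \<rho>_def px)
    have "continuous (at x) \<rho>" using cont\<rho> x0 by (simp add: continuous_on_eq_continuous_at open_Compl)
    moreover have "continuous (at (\<rho> x)) N" using N(1) by (simp add: \<rho>x differentiable_imp_continuous_within)
    ultimately have "continuous (at x) (\<lambda>w. ?p w *\<^sub>R N (\<rho> w))"
      using contp[of UNIV] continuous_at_compose[of x \<rho> N]
      by (intro continuous_intros) (auto simp: continuous_on_eq_continuous_at o_def)
    then have "continuous (at x) (dual_map K)"
      using continuous_transform_within_openin[of x UNIV _ V "dual_map K"] V eq by simp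
    \<comment> \<open>A bootstrap: continuity of the duality map gives differentiability of the
      gauge, hence of \<open>\<rho>\<close>, hence by \<open>eq\<close> of the duality map
      itself.\<close>
    then have p: "?p differentiable at x"
      using gauge_has_derivative[OF smooth x0] differentiableI by blast
    then have "\<rho> differentiable at x"
      unfolding \<rho>_def[abs_def] by (intro differentiable_scaleR differentiable_divide) (auto simp: px)
    then have "(\<lambda>w. N (\<rho> w)) differentiable at x"
      using N(1) differentiable_chain_at[of \<rho> x N] by (simp add: \<rho>x o_def)
    then have "(\<lambda>w. ?p w *\<^sub>R N (\<rho> w)) differentiable at x"
      using p by (intro differentiable_scaleR)
    then obtain D where "((\<lambda>w. ?p w *\<^sub>R N (\<rho> w)) has_derivative D) (at x)"
      by (auto simp: differentiable_def)
    then have "(dual_map K has_derivative D) (at x)"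
      by (rule has_derivative_transform_within_open[OF _ V]) (simp add: eq)
    then show ?thesis by (rule differentiableI)
  qed
  have "dual_map K differentiable at x \<and> 0 < dual_jacobian K x" if "x \<noteq> 0" for x
  proof -
    let ?z = "(1 / ?p x) *\<^sub>R x"
    have z: "?z \<in> frontier K" and p: "0 < ?p x" using normalize that by auto
    obtain A where A: "(dual_map K has_derivative A) (at ?z)"
      using frontier[OF z] by (auto simp: differentiable_def)
    have "dual_map K ?z \<noteq> 0" using that p by (simp add: dual_map_eq_0_iff[OF smooth])
    then have "0 < det (matrix A)"
      using gauss_curvature_dual_map[OF smooth z A] curv[OF z] by (metis mult_pos_pos zero_less_norm_iff zero_less_power)
    moreover have "(dual_map K has_derivative A) (at x)"
      using has_derivative_dual_map_scaleR[OF smooth p A] p by simp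
    ultimately show ?thesis by (auto simp: dual_jacobian_eq differentiable_def)
  qed
  with smooth show ?thesis by (simp add: regular_body_def)
qed


section \<open>Regular bodies and their polars\<close>

lemma regular_body_smooth: "regular_body K \<Longrightarrow> smooth_body K"
  and dual_jacobian_pos: "regular_body K \<Longrightarrow> x \<noteq> 0 \<Longrightarrow> 0 < dual_jacobian K x"
  by (auto simp: regular_body_def)

lemma regular_body_centered: "regular_body K \<Longrightarrow> centered_body K"
  by (simp add: regular_body_smooth smooth_body_centered)

lemma dual_map_has_derivative:
  assumes "regular_body K" "x \<noteq> 0"
  obtains A where "(dual_map K has_derivative A) (at x)" "det (matrix A) = dual_jacobian K x"
    "inj A" "A = frechet_derivative (dual_map K) (at x)"
proof -
  let ?A = "frechet_derivative (dual_map K) (at x)"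
  have A: "(dual_map K has_derivative ?A) (at x)"
    using assms by (simp add: regular_body_def frechet_derivative_works[symmetric])
  moreover have "det (matrix ?A) = dual_jacobian K x" by (simp add: dual_jacobian_def)
  ultimately show ?thesis
    using that[of ?A] dual_jacobian_pos[OF assms] det_nz_iff_inj[OF has_derivative_linear[OF A]] by auto
qed

lemma continuous_dual_map: "regular_body K \<Longrightarrow> continuous_on (- {0}) (dual_map K)"
  by (intro continuous_at_imp_continuous_on ballI)
     (auto simp: regular_body_def differentiable_imp_continuous_within)

lemma dual_jacobian_scaleR:
  assumes K: "regular_body K" and "0 < c"
  shows "dual_jacobian K (c *\<^sub>R x) = dual_jacobian K x"
proof (cases "x = 0")
  case False
  obtain A where A: "(dual_map K has_derivative A) (at x)"
    by (rule dual_map_has_derivative[OF K False])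
  show ?thesis
    using dual_jacobian_eq[OF A]
      dual_jacobian_eq[OF has_derivative_dual_map_scaleR[OF regular_body_smooth[OF K] \<open>0 < c\<close> A]]
    by simp
qed simp

text \<open>Two points with the same dual span a segment on which the duality map is constant,
  contradicting the invertibility of its derivative.\<close>

lemma dual_pair_left_unique:
  assumes K: "regular_body K" and 1: "dual_pair K x y" and 2: "dual_pair K x' y"
  shows "x = x'"
proof (cases "x = 0")
  case True
  then show ?thesis using 1 2 dual_pair_eq_0_iff[OF regular_body_centered[OF K]] by blast
next
  case False
  note cb = regular_body_centered[OF K] and sm = regular_body_smooth[OF K]
  note polar = polar_body_centered[OF cb]
  let ?p = "support_fun (polar_body K)"
  define c where "c = support_fun K y"
  have px: "?p x = c" "?p x' = c" and xy: "x \<bullet> y = c\<^sup>2" "x' \<bullet> y = c\<^sup>2"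
    using 1 2 by (auto simp: dual_pair_def c_def)
  have c: "0 < c" using support_pos[OF polar False] px by simp
  have const: "dual_map K (x + t *\<^sub>R (x' - x)) = y" if t: "t \<in> {0..1}" for t
  proof -
    let ?z = "x + t *\<^sub>R (x' - x)"
    have z: "?z = (1 - t) *\<^sub>R x + t *\<^sub>R x'" by (simp add: algebra_simps)
    have "?p ?z \<le> c"
      using support_add[OF polar, of "(1 - t) *\<^sub>R x" "t *\<^sub>R x'"] t px
        support_scaleR[OF polar, of "1 - t" x] support_scaleR[OF polar, of t x']
      unfolding z by (simp add: algebra_simps)
    moreover have zy: "?z \<bullet> y = c\<^sup>2"
      by (simp add: inner_add_left inner_diff_left xy)
    then have "c \<le> ?p ?z"
      using inner_le_support[OF cb, of ?z y] c by (simp add: c_def power2_eq_square)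
    ultimately show ?thesis
      using zy by (intro dual_map_unique[OF sm]) (simp add: dual_pair_def c_def)
  qed
  obtain A where A: "(dual_map K has_derivative A) (at x)" "inj A"
    by (rule dual_map_has_derivative[OF K False])
  have lin: "linear A" by (rule has_derivative_linear[OF A(1)])
  have A0: "(dual_map K has_derivative A) (at (x + 0 *\<^sub>R (x' - x)))" using A(1) by simp
  \<comment> \<open>Constancy is known only for \<open>t\<close> in \<open>{0..1}\<close>, hence a
    one-sided derivative at 0.\<close>
  have "((\<lambda>t. dual_map K (x + t *\<^sub>R (x' - x))) has_derivative (\<lambda>t. A (t *\<^sub>R (x' - x))))
      (at 0 within {0..1})"
    by (rule has_derivative_compose[where g = "dual_map K" and f = "\<lambda>t. x + t *\<^sub>R (x' - x)", OF _ A0])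
      (auto intro!: derivative_eq_intros)
  then have "((\<lambda>t. dual_map K (x + t *\<^sub>R (x' - x))) has_vector_derivative A (x' - x)) (at 0 within {0..1})"
    by (simp add: has_vector_derivative_def linear_scale[OF lin])
  moreover have "((\<lambda>t. dual_map K (x + t *\<^sub>R (x' - x))) has_vector_derivative 0) (at 0 within {0..1})"
    by (rule has_vector_derivative_transform[OF _ const, OF _ _ has_vector_derivative_const]) auto
  ultimately have "A (x' - x) = 0"
    using vector_derivative_unique_within_closed_interval[of 0 "1::real" 0] by simp
  then have "x' - x = 0"
    using injD[OF A(2), of "x' - x" 0] linear_0[OF lin] by simp
  then show ?thesis by simp
qed

text \<open>Uniqueness of duals for the polar is uniqueness of the left entry of a pair for
  \<open>K\<close>.\<close>

lemma smooth_body_polar: "regular_body K \<Longrightarrow> smooth_body (polar_body K)"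
  unfolding smooth_body_def
  using polar_body_centered dual_pair_exists dual_pair_polar_iff dual_pair_left_unique regular_body_centered
  by metis

lemma dual_map_polar_dual_map:
  assumes "regular_body K"
  shows "dual_map (polar_body K) (dual_map K x) = x" "dual_map K (dual_map (polar_body K) y) = y"
  using assms smooth_body_polar[OF assms] regular_body_smooth[OF assms] regular_body_centered[OF assms]
  by (metis dual_map_unique dual_pair_dual_map dual_pair_polar_iff)+

text \<open>The inverse is already known globally, so the inverse function theorem is applied in the
  form that asks for continuity nearby and an invertible derivative at the single point.\<close>

lemma dual_map_polar_has_derivative:
  assumes K: "regular_body K" and y: "y \<noteq> 0"
  obtains B where "(dual_map (polar_body K) has_derivative B) (at y)"
    "det (matrix B) = 1 / dual_jacobian K (dual_map (polar_body K) y)"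
proof -
  let ?x = "dual_map (polar_body K) y"
  have x: "?x \<noteq> 0" using y by (simp add: dual_map_eq_0_iff[OF smooth_body_polar[OF K]])
  obtain A where A: "(dual_map K has_derivative A) (at ?x)" "inj A" and det: "det (matrix A) = dual_jacobian K ?x"
    by (rule dual_map_has_derivative[OF K x])
  have lin: "linear A" by (rule has_derivative_linear[OF A(1)])
  obtain B where B: "linear B" "\<And>v. A (B v) = v"
    using linear_injective_isomorphism[OF lin A(2)] by auto
  have "(dual_map (polar_body K) has_derivative B) (at y)"
    by (rule has_derivative_inverse_strong_x[where f = "dual_map K" and S = "- {0}"])
      (use x A B continuous_dual_map[OF K] in \<open>auto simp: dual_map_polar_dual_map[OF K] fun_eq_iff\<close>)
  moreover have "det (matrix A) * det (matrix B) = 1"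
    using det_matrix_compose[OF lin B(1)] by (simp add: B(2) matrix_id_mat_1[unfolded id_def] det_I)
  ultimately show ?thesis
    using that det dual_jacobian_pos[OF K x] by (simp add: field_simps)
qed

proposition regular_body_polar:
  assumes K: "regular_body K"
  shows "regular_body (polar_body K)"
  unfolding regular_body_def
proof (intro conjI allI impI smooth_body_polar[OF K])
  fix y :: "real^'a" assume y: "y \<noteq> 0"
  then have "dual_map (polar_body K) y \<noteq> 0" by (simp add: dual_map_eq_0_iff[OF smooth_body_polar[OF K]])
  with y show "dual_map (polar_body K) differentiable at y" "0 < dual_jacobian (polar_body K) y"
    using dual_map_polar_has_derivative[OF K y] dual_jacobian_pos[OF K]
    by (metis dual_jacobian_eq differentiableI zero_less_divide_1_iff)+
qed

lemma dual_jacobian_polar: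
  assumes K: "regular_body K" and x: "x \<noteq> 0"
  shows "dual_jacobian (polar_body K) (dual_map K x) = 1 / dual_jacobian K x"
proof -
  have "dual_map K x \<noteq> 0" using x by (simp add: dual_map_eq_0_iff[OF regular_body_smooth[OF K]])
  from dual_map_polar_has_derivative[OF K this] show ?thesis
    by (metis dual_jacobian_eq dual_map_polar_dual_map(1)[OF K])
qed

text \<open>At the boundary point \<open>x\<close> with normal \<open>sgn y\<close> the support
  function is \<open>1 / r\<close>, so its power \<open>n + 1\<close> absorbs the factor in
  \<open>gauss_curvature_dual_map\<close> and leaves \<open>1 / dual_jacobian K x\<close>, which is
  the Jacobian of the inverse map.\<close>

proposition curvature_fun_eq_dual_jacobian:
  fixes K :: "(real^'n) set"
  assumes K: "regular_body K" and y: "y \<noteq> 0"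
  shows "curvature_fun K (sgn y) * support_fun K (sgn y) ^ (CARD('n) + 1) = dual_jacobian (polar_body K) y"
proof -
  note cb = regular_body_centered[OF K] and sm = regular_body_smooth[OF K]
  note polar = polar_body_centered[OF cb]
  let ?p = "support_fun (polar_body K)"
  \<comment> \<open>The preimage of \<open>y\<close> under \<open>dual_map K\<close> has gauge
    \<open>support_fun K y\<close>; dividing by it gives a boundary point.\<close>
  define x where "x = (1 / support_fun K y) *\<^sub>R dual_map (polar_body K) y"
  define r where "r = norm (dual_map K x)"
  have hy: "0 < support_fun K y" by (rule support_pos[OF cb y])
  have \<Psi>x: "dual_map K x = (1 / support_fun K y) *\<^sub>R y"
    using hy by (simp add: x_def dual_map_scaleR[OF sm] dual_map_polar_dual_map[OF K])
  then have \<Psi>x0: "dual_map K x \<noteq> 0" using y hy by simp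
  then have x0: "x \<noteq> 0" by (simp add: dual_map_eq_0_iff[OF sm])
  have r0: "0 < r" using \<Psi>x0 by (simp add: r_def)
  have px: "?p x = 1"
    using support_dual_map[OF sm, of x] hy by (simp add: \<Psi>x support_scaleR[OF cb])
  then have fr: "x \<in> frontier K" by (simp add: frontier_iff[OF cb])
  have sgn: "sgn (dual_map K x) = sgn y"
    using hy by (simp add: \<Psi>x sgn_scaleR)
  have "(THE z. z \<in> frontier K \<and> outer_normal K z = sgn y) = x"
  proof (rule the_equality)
    show "x \<in> frontier K \<and> outer_normal K x = sgn y"
      using fr sgn by (simp add: outer_normal_dual_map[OF sm])
    fix z assume "z \<in> frontier K \<and> outer_normal K z = sgn y"
    then have z: "z \<in> frontier K" "outer_normal K z = sgn y" by auto
    then have pz: "?p z = 1" and "sgn (dual_map K z) = sgn (dual_map K x)"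
      using sgn outer_normal_dual_map[OF sm z(1)] by (simp_all add: frontier_iff[OF cb])
    \<comment> \<open>Equal normals make the duals of \<open>z\<close> and \<open>x\<close>
      positively proportional; injectivity transfers this to the points, and the common gauge 1
      makes the factor 1.\<close>
    have "dual_map K z = norm (dual_map K z) *\<^sub>R sgn (dual_map K z)"
      by (cases "dual_map K z = 0") (simp_all add: sgn_div_norm)
    also have "\<dots> = (norm (dual_map K z) / r) *\<^sub>R dual_map K x"
      unfolding \<open>sgn (dual_map K z) = sgn (dual_map K x)\<close>
      by (simp add: sgn_div_norm r_def divide_inverse)
    also have "\<dots> = dual_map K ((norm (dual_map K z) / r) *\<^sub>R x)"
      using r0 by (simp add: dual_map_scaleR[OF sm])
    finally have zx: "z = (norm (dual_map K z) / r) *\<^sub>R x"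
      using dual_map_polar_dual_map(1)[OF K] by metis
    then have "?p z = norm (dual_map K z) / r * ?p x"
      using support_scaleR[OF polar] r0 by (metis divide_nonneg_pos norm_ge_zero)
    then have "norm (dual_map K z) / r = 1" by (simp only: px pz mult_1_right)
    then show "z = x" using zx by (simp only: scaleR_one)
  qed
  then have "curvature_fun K (sgn y) = 1 / gauss_curvature K x" by (simp add: curvature_fun_def)
  moreover obtain A where A: "(dual_map K has_derivative A) (at x)" "det (matrix A) = dual_jacobian K x"
    by (rule dual_map_has_derivative[OF K x0])
  then have "gauss_curvature K x * r ^ (CARD('n) + 1) = dual_jacobian K x"
    using gauss_curvature_dual_map[OF sm fr] by (simp add: r_def)
  moreover have "sgn y = (1 / r) *\<^sub>R dual_map K x"
    unfolding sgn[symmetric] by (simp add: sgn_div_norm r_def inverse_eq_divide)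
  then have "support_fun K (sgn y) = 1 / r"
    using px r0 by (simp add: support_scaleR[OF cb] support_dual_map[OF sm])
  moreover have "dual_jacobian (polar_body K) y = 1 / dual_jacobian K x"
    using dual_jacobian_polar[OF K x0] hy dual_jacobian_scaleR[OF regular_body_polar[OF K], of "1 / support_fun K y" y]
    by (simp add: \<Psi>x)
  ultimately show ?thesis by (simp only: power_one_over) simp
qed

section \<open>Measurability of the duality map and of its Jacobian\<close>

lemma borel_measurable_dual_map:
  assumes K: "regular_body K"
  shows "dual_map K \<in> borel_measurable borel"
proof -
  have "(\<lambda>x. indicator (- {0}) x *\<^sub>R dual_map K x) \<in> borel_measurable borel"
    by (intro borel_measurable_continuous_on_indicator continuous_dual_map[OF K]) simp
  moreover have "indicator (- {0}) x *\<^sub>R dual_map K x = dual_map K x" for x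
    using dual_map_eq_0_iff[OF regular_body_smooth[OF K]] by (cases "x = 0") auto
  ultimately show ?thesis by simp
qed

text \<open>Regularity gives no continuity of the derivative, but each entry is a pointwise limit of
  difference quotients of a Borel map. The indicator discards the origin, where differentiability is
  not assumed.\<close>

lemma borel_measurable_dual_jacobian:
  fixes K :: "(real^'n) set"
  assumes K: "regular_body K"
  shows "(\<lambda>x. indicator (- {0}) x * dual_jacobian K x) \<in> borel_measurable borel"
proof -
  let ?D = "\<lambda>x. frechet_derivative (dual_map K) (at x)"
  let ?I = "\<lambda>x. indicator (- {0}) x :: real"
  note [measurable] = borel_measurable_dual_map[OF K]
  have nth[measurable]: "(\<lambda>x::real^'n. x $ i) \<in> borel_measurable borel" for i
    by (intro borel_measurable_continuous_onI continuous_intros)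
  have D[measurable]: "(\<lambda>x. ?I x * ?D x v $ i) \<in> borel_measurable borel" for v i
  proof (rule borel_measurable_LIMSEQ_real)
    define \<delta> where "\<delta> k = inverse (real (Suc k))" for k
    let ?q = "\<lambda>k x. ?I x * ((dual_map K (x + \<delta> k *\<^sub>R v) $ i - dual_map K x $ i) / \<delta> k)"
    show "?q k \<in> borel_measurable borel" for k by measurable
    fix x :: "real^'n"
    show "(\<lambda>k. ?q k x) \<longlonglongrightarrow> ?I x * ?D x v $ i"
    proof (cases "x = 0")
      case False
      obtain A where A: "(dual_map K has_derivative A) (at x)" "A = ?D x"
        by (rule dual_map_has_derivative[OF K False])
      have A0: "(dual_map K has_derivative A) (at (x + 0 *\<^sub>R v))" using A by simp
      have "((\<lambda>t. dual_map K (x + t *\<^sub>R v)) has_derivative (\<lambda>t. A (t *\<^sub>R v))) (at 0)"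
        by (rule has_derivative_compose[where g = "dual_map K" and f = "\<lambda>t. x + t *\<^sub>R v", OF _ A0])
          (auto intro!: derivative_eq_intros)
      from bounded_linear.has_derivative[OF bounded_linear_vec_nth this]
      have "((\<lambda>t. dual_map K (x + t *\<^sub>R v) $ i) has_real_derivative A v $ i) (at 0)"
        by (rule has_derivative_imp_has_field_derivative)
          (simp add: linear_scale[OF has_derivative_linear[OF A(1)]])
      then have lim: "((\<lambda>t. (dual_map K (x + t *\<^sub>R v) $ i - dual_map K x $ i) / t) \<longlongrightarrow> A v $ i) (at 0)"
        by (simp add: DERIV_def)
      have "filterlim \<delta> (at 0) sequentially"
        unfolding filterlim_at \<delta>_def using LIMSEQ_inverse_real_of_nat by simp
      from filterlim_compose[OF lim this] show ?thesis using A(2) False by simp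
    qed simp
  qed
  \<comment> \<open>The inner indicators make the entries measurable; the outer one makes both sides
    vanish at 0 in the comparison below.\<close>
  have "(\<lambda>x. ?I x * det (\<chi> i j. ?I x * ?D x (axis j 1) $ i)) \<in> borel_measurable borel"
    unfolding det_def vec_lambda_beta by measurable
  moreover have "?I x * det (\<chi> i j. ?I x * ?D x (axis j 1) $ i) = ?I x * dual_jacobian K x" for x
    by (cases "x = 0") (simp_all add: dual_jacobian_def matrix_def)
  ultimately show ?thesis by simp
qed


section \<open>Integration over the sphere\<close>

text \<open>Passing through the nonnegative integral covers divergence as well:
  \<open>enn2real\<close> sends infinity to 0, which is also the default of the Bochner
  integral.\<close>

lemma lebesgue_integral_sphere_measure:
  fixes G :: "'a::euclidean_space \<Rightarrow> real"
  assumes G: "G \<in> borel_measurable (restrict_space borel (sphere 0 1))" and pos: "\<And>u. 0 \<le> G u"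
  shows "(LINT u|sphere_measure. G u) = real DIM('a) * (LINT x:ball 0 1 - {0}|lborel. G (sgn x))"
proof -
  let ?B = "ball 0 1 - {0} :: 'a set"
  let ?M = "restrict_space lborel ?B" and ?N = "restrict_space borel (sphere 0 1 :: 'a set)"
  have "sgn \<in> borel_measurable (borel :: 'a measure)"
    unfolding sgn_div_norm by measurable
  then have "sgn \<in> measurable ?M (borel :: 'a measure)"
    by (intro measurable_restrict_space1) simp
  then have sgn: "sgn \<in> measurable ?M ?N"
    by (intro measurable_restrict_space2) (auto simp: space_restrict_space norm_sgn)
  have Gs: "(\<lambda>x. G (sgn x)) \<in> borel_measurable ?M" using measurable_compose[OF sgn G] .
  have G': "G \<in> borel_measurable sphere_measure"
    using G by (simp add: sphere_measure_def cong: measurable_cong_sets)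
  have "(LINT u|sphere_measure. G u) = enn2real (\<integral>\<^sup>+u. ennreal (G u) \<partial>sphere_measure)"
    by (rule integral_eq_nn_integral[OF G']) (simp add: pos)
  also have "(\<integral>\<^sup>+u. ennreal (G u) \<partial>sphere_measure)
      = of_nat DIM('a) * (\<integral>\<^sup>+u. ennreal (G u) \<partial>distr ?M ?N sgn)"
    unfolding sphere_measure_def using G by (intro nn_integral_scale_measure) simp
  also have "(\<integral>\<^sup>+u. ennreal (G u) \<partial>distr ?M ?N sgn) = (\<integral>\<^sup>+x. ennreal (G (sgn x)) \<partial>?M)"
    using G by (intro nn_integral_distr[OF sgn]) simp
  also have "enn2real (of_nat DIM('a) * (\<integral>\<^sup>+x. ennreal (G (sgn x)) \<partial>?M))
      = real DIM('a) * (LINT x|?M. G (sgn x))"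
    using integral_eq_nn_integral[OF Gs] pos by (simp add: enn2real_mult)
  also have "(LINT x|?M. G (sgn x)) = (LINT x:?B|lborel. G (sgn x))"
    unfolding set_lebesgue_integral_def by (rule integral_restrict_space) simp
  finally show ?thesis .
qed

lemma homogeneous_derivative_radial:
  fixes f :: "'a::real_normed_vector \<Rightarrow> 'b::real_normed_vector"
  assumes der: "(f has_derivative f') (at x)" and hom: "\<And>t. 0 < t \<Longrightarrow> f (t *\<^sub>R x) = f x"
  shows "f' x = 0"
proof -
  have der1: "(f has_derivative f') (at (1 *\<^sub>R x))" using der by simp
  have "((\<lambda>t. f (t *\<^sub>R x)) has_derivative (\<lambda>t. f' (t *\<^sub>R x))) (at 1)"
    by (rule has_derivative_compose[where g = f and f = "\<lambda>t. t *\<^sub>R x", OF _ der1])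
      (auto intro!: derivative_eq_intros)
  then have "((\<lambda>t. f (t *\<^sub>R x)) has_vector_derivative f' x) (at 1)"
    by (simp add: has_vector_derivative_def linear_scale[OF has_derivative_linear[OF der]])
  moreover have "((\<lambda>t. f (t *\<^sub>R x)) has_vector_derivative 0) (at 1)"
    by (rule has_vector_derivative_transform_within_open[OF has_vector_derivative_const, where S = "{0<..}"])
      (auto simp: hom)
  ultimately show ?thesis by (rule vector_derivative_unique_at)
qed

text \<open>Rescaled to preserve norms, the duality map sends the punctured unit ball onto itself.
  The substitution on the sphere thereby becomes a change of variables in the ball that defines
  \<open>sphere_measure\<close>.\<close>

definition radial_dual_map :: "'a::euclidean_space set \<Rightarrow> 'a \<Rightarrow> 'a" where
  "radial_dual_map K x = (norm x / norm (dual_map K x)) *\<^sub>R dual_map K x"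

text \<open>The scaling factor \<open>W\<close> has degree zero, so its gradient \<open>a\<close> is
  orthogonal to \<open>x\<close>. As \<open>dual_map K x = A x\<close>, the extra term of the
  product rule amounts to a shear along \<open>x\<close> applied before \<open>A\<close>, which
  leaves the determinant unchanged; only \<open>W x ^ n\<close> remains.\<close>

lemma radial_dual_map_has_derivative:
  fixes K :: "(real^'n) set"
  assumes K: "regular_body K" and x: "x \<noteq> 0"
  obtains M where "(radial_dual_map K has_derivative M) (at x)"
    "det (matrix M) = (norm x / norm (dual_map K x)) ^ CARD('n) * dual_jacobian K x"
proof -
  note sm = regular_body_smooth[OF K]
  have \<Psi>0: "dual_map K x \<noteq> 0" using x by (simp add: dual_map_eq_0_iff[OF sm])
  define W where "W x = norm x / norm (dual_map K x)" for x
  have W0: "0 < W x" using x \<Psi>0 by (simp add: W_def)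
  obtain A where A: "(dual_map K has_derivative A) (at x)" "det (matrix A) = dual_jacobian K x"
    by (rule dual_map_has_derivative[OF K x])
  have lin: "linear A" by (rule has_derivative_linear[OF A(1)])
  have "(\<lambda>x. norm (dual_map K x)) differentiable at x"
    using differentiable_chain_at[of "dual_map K" x norm] differentiableI[OF A(1)]
      differentiableI[OF has_derivative_norm[OF \<Psi>0]] by (simp add: o_def)
  then have "W differentiable at x"
    unfolding W_def[abs_def] using \<Psi>0 differentiableI[OF has_derivative_norm[OF x]]
    by (intro differentiable_divide) auto
  then obtain w where w: "(W has_derivative w) (at x)" by (auto simp: differentiable_def)
  have wx: "w x = 0"
    by (rule homogeneous_derivative_radial[OF w]) (simp add: W_def dual_map_scaleR[OF sm])
  define a where "a = adjoint w 1"
  have a: "w v = a \<bullet> v" for v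
    using adjoint_works[OF has_derivative_linear[OF w], of v 1] by (simp add: a_def inner_commute)
  let ?S = "\<lambda>v. v + (((1 / W x) *\<^sub>R a) \<bullet> v) *\<^sub>R x"
  have "(radial_dual_map K has_derivative (\<lambda>v. W x *\<^sub>R A v + w v *\<^sub>R dual_map K x)) (at x)"
    unfolding radial_dual_map_def[abs_def] W_def[symmetric]
    by (rule has_derivative_scaleR[OF w A(1)])
  moreover have "W x *\<^sub>R A v + w v *\<^sub>R dual_map K x = W x *\<^sub>R A (?S v)" for v
    using W0 by (simp add: linear_add[OF lin] linear_scale[OF lin] dual_map_euler[OF sm A(1)] a scaleR_add_right)
  moreover have "det (matrix (\<lambda>v. W x *\<^sub>R A (?S v))) = W x ^ CARD('n) * dual_jacobian K x"
  proof -
    have "a \<bullet> x = 0" using a[of x] wx by simp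
    then have "det (matrix ?S) = 1" unfolding det_rank_one_update by simp
    then show ?thesis
      unfolding det_matrix_scaleR det_matrix_compose[OF lin linear_rank_one_update] by (simp only: A(2) mult_1_right)
  qed
  ultimately show ?thesis using that by (simp add: W_def)
qed

lemma radial_dual_map_norm: "smooth_body K \<Longrightarrow> norm (radial_dual_map K x) = norm x"
  using dual_map_eq_0_iff[of K x] by (auto simp: radial_dual_map_def)

lemma sgn_radial_dual_map: "smooth_body K \<Longrightarrow> sgn (radial_dual_map K x) = sgn (dual_map K x)"
  using dual_map_eq_0_iff[of K x] by (cases "x = 0") (auto simp: radial_dual_map_def sgn_scaleR)

lemma radial_dual_map_polar:
  assumes K: "regular_body K"
  shows "radial_dual_map (polar_body K) (radial_dual_map K x) = x"
proof (cases "x = 0")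
  case False
  note sm = regular_body_smooth[OF K]
  have "dual_map K x \<noteq> 0" using False by (simp add: dual_map_eq_0_iff[OF sm])
  then show ?thesis
    using False unfolding radial_dual_map_def
    by (simp add: dual_map_scaleR[OF smooth_body_polar[OF K]] dual_map_polar_dual_map[OF K])
qed (simp add: radial_dual_map_def)

text \<open>Both sides are integrals over the punctured ball, related by
  \<open>radial_dual_map K\<close>. The absolute value keeps the right-hand integrand nonnegative at
  0 too, where the sign of the Jacobian is unknown.\<close>

proposition sphere_integral_dual_map:
  fixes K :: "(real^'n) set" and G :: "real^'n \<Rightarrow> real"
  assumes K: "regular_body K"
    and G: "G \<in> borel_measurable (restrict_space borel (sphere 0 1))" and pos: "\<And>u. 0 \<le> G u"
  shows "(LINT u|sphere_measure. G u) =
    (LINT v|sphere_measure. G (sgn (dual_map K v)) * (\<bar>dual_jacobian K v\<bar> / norm (dual_map K v) ^ CARD('n)))"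
proof -
  let ?B = "ball 0 1 - {0} :: (real^'n) set" and ?S = "sphere 0 1 :: (real^'n) set"
  let ?H = "\<lambda>v. G (sgn (dual_map K v)) * (\<bar>dual_jacobian K v\<bar> / norm (dual_map K v) ^ CARD('n))"
  note sm = regular_body_smooth[OF K]
  have "\<exists>M. x \<noteq> 0 \<longrightarrow> (radial_dual_map K has_derivative M) (at x) \<and>
      det (matrix M) = (norm x / norm (dual_map K x)) ^ CARD('n) * dual_jacobian K x" for x
    using radial_dual_map_has_derivative[OF K, of x] by blast
  then obtain M where M: "\<And>x. x \<noteq> 0 \<Longrightarrow> (radial_dual_map K has_derivative M x) (at x)"
    "\<And>x. x \<noteq> 0 \<Longrightarrow> det (matrix (M x)) = (norm x / norm (dual_map K x)) ^ CARD('n) * dual_jacobian K x"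
    by metis
  have J: "(\<lambda>x. dual_jacobian K x) \<in> borel_measurable (restrict_space borel T)" if "0 \<notin> T" for T
  proof -
    have "(\<lambda>x. indicator (- {0}) x * dual_jacobian K x) \<in> borel_measurable (restrict_space borel T)"
      by (rule measurable_restrict_space1[OF borel_measurable_dual_jacobian[OF K]])
    then show ?thesis
      by (rule measurable_cong[THEN iffD1, rotated])
        (use that in \<open>auto simp: space_restrict_space indicator_def\<close>)
  qed
  have \<Psi>: "dual_map K \<in> borel_measurable (restrict_space borel T)" for T
    by (rule measurable_restrict_space1[OF borel_measurable_dual_map[OF K]])
  have sgn: "sgn \<in> borel_measurable (borel :: (real^'n) measure)"
    unfolding sgn_div_norm by measurable
  have H: "?H \<in> borel_measurable (restrict_space borel T)" if "0 \<notin> T" for T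
  proof -
    have "(\<lambda>v. sgn (dual_map K v)) \<in> measurable (restrict_space borel T) (restrict_space borel ?S)"
      using measurable_compose[OF \<Psi> sgn] that dual_map_eq_0_iff[OF sm]
      by (intro measurable_restrict_space2) (auto simp: space_restrict_space norm_sgn)
    from measurable_compose[OF this G] show ?thesis
      using J[OF that] \<Psi>[of T] by measurable
  qed
  have Gs: "(\<lambda>x. G (sgn x)) \<in> borel_measurable (restrict_space borel T)" if "0 \<notin> T" for T
  proof (rule measurable_compose[OF _ G])
    show "sgn \<in> measurable (restrict_space borel T) (restrict_space borel ?S)"
      using that by (intro measurable_restrict_space2 measurable_restrict_space1 sgn)
        (auto simp: space_restrict_space norm_sgn)
  qed
  \<comment> \<open>The Jacobian has degree zero and the duality map degree one, so the weight
    depends on the direction of \<open>x\<close> only.\<close>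
  have Hs: "\<bar>det (matrix (M x))\<bar> * G (sgn (radial_dual_map K x)) = ?H (sgn x)" if x: "x \<noteq> 0" for x
  proof -
    have "dual_map K (sgn x) = (1 / norm x) *\<^sub>R dual_map K x"
      by (simp add: sgn_div_norm dual_map_scaleR[OF sm] inverse_eq_divide)
    moreover have "dual_jacobian K (sgn x) = dual_jacobian K x"
      using x dual_jacobian_scaleR[OF K, of "inverse (norm x)" x] by (simp add: sgn_div_norm)
    ultimately show ?thesis
      using x by (simp add: M(2) sgn_radial_dual_map[OF sm] abs_mult sgn_scaleR power_divide)
  qed
  have im: "radial_dual_map K ` ?B = ?B"
  proof -
    have in_B: "radial_dual_map K' x \<in> ?B" if "smooth_body K'" "x \<in> ?B" for K' x
    proof -
      have "norm (radial_dual_map K' x) = norm x" by (rule radial_dual_map_norm[OF that(1)])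
      moreover from this have "radial_dual_map K' x \<noteq> 0" using that(2) by force
      ultimately show ?thesis using that(2) by simp
    qed
    have surj: "x \<in> radial_dual_map K ` ?B" if "x \<in> ?B" for x
    proof (rule image_eqI)
      show "x = radial_dual_map K (radial_dual_map (polar_body K) x)"
        using radial_dual_map_polar[OF regular_body_polar[OF K], of x]
        by (simp add: polar_polar[OF regular_body_centered[OF K]])
      show "radial_dual_map (polar_body K) x \<in> ?B"
        using in_B[OF smooth_body_polar[OF K] that] .
    qed
    show ?thesis
      by (intro subset_antisym image_subsetI subsetI in_B[OF sm] surj)
  qed
  have set_meas: "set_borel_measurable borel T f"
    if "f \<in> borel_measurable (restrict_space borel T)" "T \<in> sets borel" for T and f :: "real^'n \<Rightarrow> real"
    using that borel_measurable_restrict_space_iff[of T borel f] by (simp add: set_borel_measurable_def)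
  have HS: "(\<lambda>x. ?H (sgn x)) \<in> borel_measurable (restrict_space borel ?B)"
  proof (rule measurable_compose[OF _ H])
    show "sgn \<in> measurable (restrict_space borel ?B) (restrict_space borel ?S)"
      by (intro measurable_restrict_space2 measurable_restrict_space1 sgn)
        (auto simp: space_restrict_space norm_sgn)
  qed simp
  have "(LINT x:?B|lborel. \<bar>det (matrix (M x))\<bar> * G (sgn (radial_dual_map K x)))
      = (LINT x:radial_dual_map K ` ?B|lborel. G (sgn x))"
  proof (rule set_lborel_change_of_variables)
    show "inj_on (radial_dual_map K) ?B"
      by (rule inj_on_inverseI[of _ "radial_dual_map (polar_body K)"]) (simp add: radial_dual_map_polar[OF K])
    show "set_borel_measurable borel (radial_dual_map K ` ?B) (\<lambda>x. G (sgn x))"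
      unfolding im by (intro set_meas Gs) auto
    show "set_borel_measurable borel ?B (\<lambda>x. \<bar>det (matrix (M x))\<bar> * G (sgn (radial_dual_map K x)))"
    proof (rule set_meas)
      show "(\<lambda>x. \<bar>det (matrix (M x))\<bar> * G (sgn (radial_dual_map K x))) \<in> borel_measurable (restrict_space borel ?B)"
        by (rule measurable_cong[THEN iffD2, OF Hs HS]) (auto simp: space_restrict_space)
    qed simp
  qed (auto intro: has_derivative_at_withinI M)
  also have "(LINT x:?B|lborel. \<bar>det (matrix (M x))\<bar> * G (sgn (radial_dual_map K x)))
      = (LINT x:?B|lborel. ?H (sgn x))"
    by (intro set_lebesgue_integral_cong) (auto simp: Hs)
  finally have "(LINT x:?B|lborel. ?H (sgn x)) = (LINT x:?B|lborel. G (sgn x))" by (simp only: im)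
  then show ?thesis
    using lebesgue_integral_sphere_measure[OF G pos] lebesgue_integral_sphere_measure[OF H[of ?S]] pos
    by simp
qed


section \<open>Mixed affine surface areas\<close>

lemma dual_map_image_scaleR:
  assumes L: "regular_body L" and cL: "smooth_body ((\<lambda>x. c *\<^sub>R x) ` L)" and c: "0 < c"
  shows "dual_map ((\<lambda>x. c *\<^sub>R x) ` L) x = (1 / c\<^sup>2) *\<^sub>R dual_map L x"
  using dual_pair_dual_map[OF regular_body_smooth[OF L], of x] c
  by (intro dual_map_unique[OF cL]) (simp add: dual_pair_image_scaleR[OF regular_body_centered[OF L] c])

lemma dual_jacobian_image_scaleR:
  fixes L :: "(real^'n) set"
  assumes L: "regular_body L" and cL: "smooth_body ((\<lambda>x. c *\<^sub>R x) ` L)" and c: "0 < c" and x: "x \<noteq> 0"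
  shows "dual_jacobian ((\<lambda>x. c *\<^sub>R x) ` L) x = (1 / c\<^sup>2) ^ CARD('n) * dual_jacobian L x"
proof -
  obtain A where A: "(dual_map L has_derivative A) (at x)" "det (matrix A) = dual_jacobian L x"
    by (rule dual_map_has_derivative[OF L x])
  have "(dual_map ((\<lambda>x. c *\<^sub>R x) ` L) has_derivative (\<lambda>v. (1 / c\<^sup>2) *\<^sub>R A v)) (at x)"
    unfolding dual_map_image_scaleR[OF L cL c, abs_def] by (rule has_derivative_scaleR_right[OF A(1)])
  from dual_jacobian_eq[OF this] show ?thesis by (simp only: det_matrix_scaleR A(2))
qed

lemma Conc_pos: "\<phi> \<in> Conc \<Longrightarrow> 0 < t \<Longrightarrow> 0 < \<phi> t"
  by (auto simp: Conc_def)

text \<open>Concave functions on an open interval are continuous; this makes the integrands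
  measurable.\<close>

lemma Conc_continuous_on:
  assumes "\<phi> \<in> Conc"
  shows "continuous_on {0<..} \<phi>"
proof -
  consider c where "\<And>t. 0 < t \<Longrightarrow> \<phi> t = c" | "concave_on {0<..} \<phi>"
    using assms by (auto simp: Conc_def)
  then show ?thesis
  proof cases
    case 1
    then show ?thesis by (metis continuous_on_const continuous_on_cong greaterThan_iff)
  next
    case 2
    then have "continuous_on {0<..} (\<lambda>t. - \<phi> t)"
      by (intro convex_on_continuous) (simp_all add: concave_on_def)
    from continuous_on_minus[OF this] show ?thesis by simp
  qed
qed

text \<open>Serves to distribute the density of the substitution evenly over the \<open>n\<close>
  factors of the integrand.\<close>

lemma prod_powr_mult_const:
  assumes "finite I" "card I = n" "0 < n" "0 \<le> c" "\<And>i. i \<in> I \<Longrightarrow> 0 \<le> a i"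
  shows "(\<Prod>i\<in>I. a i powr (1 / real n)) * c = (\<Prod>i\<in>I. (a i * c) powr (1 / real n))"
proof -
  have "(\<Prod>i\<in>I. (a i * c) powr (1 / real n)) = (\<Prod>i\<in>I. a i powr (1 / real n)) * (\<Prod>i\<in>I. c powr (1 / real n))"
    unfolding prod.distrib[symmetric] using assms by (intro prod.cong) (auto simp: powr_mult)
  also have "(\<Prod>i\<in>I. c powr (1 / real n)) = c"
    using assms by (cases "c = 0") (simp_all add: powr_power)
  finally show ?thesis by simp
qed

text \<open>After the substitution by \<open>L\<close> the integrands agree factor by factor: this
  is \<open>eq\<close>, once the density \<open>c\<close> has been absorbed into the roots.\<close>

proposition mixed_affine_area_star_eq_polar:
  fixes K :: "nat \<Rightarrow> (real^'n) set"
  assumes K: "\<And>i. i \<in> {1..CARD('n)} \<Longrightarrow> regular_body (K i)"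
    and L: "regular_body L"
    and l: "\<And>i. i \<in> {1..CARD('n)} \<Longrightarrow> 0 < l i"
    and Kl: "\<And>i. i \<in> {1..CARD('n)} \<Longrightarrow> K i = (\<lambda>x. l i *\<^sub>R x) ` L"
    and \<phi>: "\<And>i. i \<in> {1..CARD('n)} \<Longrightarrow> \<phi> i \<in> Conc"
  shows "mixed_affine_area_star \<phi> K = mixed_affine_area \<phi> (\<lambda>i. polar_body (K i))"
proof -
  let ?n = "CARD('n)" and ?S = "sphere 0 1 :: (real^'n) set"
  define b where "b i u = \<phi> i (curvature_fun (K i) u * support_fun (K i) u ^ (?n + 1)) / support_fun (K i) u ^ ?n" for i u
  define G where "G u = (\<Prod>i=1..?n. b i u powr (1 / real ?n))" for u
  note smL = regular_body_smooth[OF L]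
  have sphere: "u \<noteq> 0" "sgn u = u" if "u \<in> ?S" for u
    using that by (auto simp: sgn_div_norm)
  have F: "curvature_fun (K i) u * support_fun (K i) u ^ (?n + 1) = dual_jacobian (polar_body (K i)) u"
    if "i \<in> {1..?n}" "u \<in> ?S" for i u
    using curvature_fun_eq_dual_jacobian[OF K[OF that(1)] sphere(1)[OF that(2)]] by (simp only: sphere(2)[OF that(2)])
  have G_meas: "G \<in> borel_measurable (restrict_space borel ?S)"
    unfolding G_def
  proof (intro borel_measurable_prod powr_real_measurable borel_measurable_const)
    fix i assume i: "i \<in> {1..?n}"
    note cb = regular_body_centered[OF K[OF i]] and polar = regular_body_polar[OF K[OF i]]
    \<comment> \<open>Membership in \<open>Conc\<close> says nothing about \<open>\<phi> i\<close>
      outside \<open>{0<..}\<close>. The indicator cuts this off, and on the sphere the argument is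
      positive.\<close>
    have ind: "(\<lambda>t. indicator {0<..} t *\<^sub>R \<phi> i t) \<in> borel_measurable borel"
      by (intro borel_measurable_continuous_on_indicator Conc_continuous_on \<phi> i) simp
    have supp: "support_fun (K i) \<in> borel_measurable (restrict_space borel ?S)"
      by (intro measurable_restrict_space1 borel_measurable_continuous_onI continuous_support[OF cb])
    let ?b = "\<lambda>u. indicator {0<..} (indicator (- {0}) u * dual_jacobian (polar_body (K i)) u) *\<^sub>R
        \<phi> i (indicator (- {0}) u * dual_jacobian (polar_body (K i)) u) / support_fun (K i) u ^ ?n"
    have "?b \<in> borel_measurable (restrict_space borel ?S)"
      using supp measurable_compose[OF measurable_restrict_space1[OF borel_measurable_dual_jacobian[OF polar]] ind]
      by measurable
    moreover have "b i u = ?b u" if "u \<in> ?S" for u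
      using sphere(1)[OF that] F[OF i that] dual_jacobian_pos[OF polar sphere(1)[OF that]]
      by (simp add: b_def)
    ultimately show "b i \<in> borel_measurable (restrict_space borel ?S)"
      by (subst measurable_cong[where g = ?b]) (auto simp: space_restrict_space)
  qed
  have b_pos: "0 < b i u" if "i \<in> {1..?n}" "u \<in> ?S" for i u
  proof -
    have "0 < dual_jacobian (polar_body (K i)) u"
      by (rule dual_jacobian_pos[OF regular_body_polar[OF K[OF that(1)]] sphere(1)[OF that(2)]])
    moreover have "0 < support_fun (K i) u"
      by (rule support_pos[OF regular_body_centered[OF K[OF that(1)]] sphere(1)[OF that(2)]])
    ultimately show ?thesis
      unfolding b_def F[OF that] by (rule divide_pos_pos[OF Conc_pos[OF \<phi>[OF that(1)]] zero_less_power])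
  qed
  have "mixed_affine_area_star \<phi> K = (LINT u|sphere_measure. G u)"
    unfolding mixed_affine_area_star_def G_def b_def by (rule refl)
  also have "\<dots> = (LINT v|sphere_measure. G (sgn (dual_map L v)) * (\<bar>dual_jacobian L v\<bar> / norm (dual_map L v) ^ ?n))"
    by (rule sphere_integral_dual_map[OF L G_meas]) (simp add: G_def prod_nonneg)
  also have "\<dots> = mixed_affine_area \<phi> (\<lambda>i. polar_body (K i))"
    unfolding mixed_affine_area_def
  proof (rule Bochner_Integration.integral_cong[OF refl])
    fix v :: "real^'n" assume "v \<in> space sphere_measure"
    then have v: "v \<in> ?S" by (simp add: sphere_measure_def space_scale_measure space_restrict_space)
    note v0 = sphere(1)[OF v]
    define u where "u = sgn (dual_map L v)"
    define c where "c = dual_jacobian L v / norm (dual_map L v) ^ ?n"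
    have \<Psi>0: "dual_map L v \<noteq> 0" using v0 by (simp add: dual_map_eq_0_iff[OF smL])
    then have u: "u \<in> ?S" by (simp add: u_def norm_sgn)
    have J: "0 < dual_jacobian L v" by (rule dual_jacobian_pos[OF L v0])
    then have c: "0 < c" using \<Psi>0 by (simp add: c_def)
    have eq: "b i u * c = \<phi> i (1 / (curvature_fun (polar_body (K i)) v * support_fun (polar_body (K i)) v ^ (?n + 1)))
        * support_fun (polar_body (K i)) v * curvature_fun (polar_body (K i)) v" if i: "i \<in> {1..?n}" for i
    proof -
      note Ki = K[OF i]
      note sm = regular_body_smooth[OF Ki] and cb = regular_body_centered[OF Ki]
      let ?p = "support_fun (polar_body (K i)) v" and ?J = "dual_jacobian (K i) v" and ?r = "norm (dual_map L v)"
      have p: "0 < ?p" by (rule support_pos[OF polar_body_centered[OF cb] v0])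
      have li: "0 < l i" by (rule l[OF i])
      have \<Psi>: "dual_map (K i) v = (1 / (l i)\<^sup>2) *\<^sub>R dual_map L v"
        using dual_map_image_scaleR[OF L _ li] sm by (simp add: Kl[OF i])
      \<comment> \<open>The same direction \<open>u\<close> serves every \<open>i\<close>; only the
        positive factor depends on \<open>l i\<close>.\<close>
      have u\<Psi>: "u = ((l i)\<^sup>2 / ?r) *\<^sub>R dual_map (K i) v"
        using li by (simp add: \<Psi> u_def sgn_div_norm inverse_eq_divide)
      have JK: "?J = (1 / (l i)\<^sup>2) ^ ?n * dual_jacobian L v"
        using dual_jacobian_image_scaleR[OF L _ li v0] sm by (simp add: Kl[OF i])
      have "dual_jacobian (polar_body (K i)) u = 1 / ?J"
        unfolding u\<Psi> using \<Psi>0 li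
        by (simp add: dual_jacobian_scaleR[OF regular_body_polar[OF Ki]] dual_jacobian_polar[OF Ki v0])
      moreover have "support_fun (K i) u = (l i)\<^sup>2 / ?r * ?p"
        unfolding u\<Psi> using li by (simp add: support_scaleR[OF cb] support_dual_map[OF sm])
      moreover have "b i u = \<phi> i (dual_jacobian (polar_body (K i)) u) / support_fun (K i) u ^ ?n"
        unfolding b_def F[OF i u] by (rule refl)
      ultimately have "b i u = \<phi> i (1 / ?J) / ((l i)\<^sup>2 / ?r * ?p) ^ ?n" by (simp only:)
      \<comment> \<open>\<open>?r ^ ?n\<close> cancels between \<open>c\<close> and the support
        function, and the remaining divisor \<open>(l i) ^ (2 * ?n)\<close> turns the Jacobian of
        \<open>L\<close> into that of \<open>K i\<close>.\<close>
      then have "b i u * c = \<phi> i (1 / ?J) * (?J / ?p ^ ?n)"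
        using \<Psi>0 li p J by (simp only: c_def JK) (simp add: power_mult_distrib power_divide)
      moreover have Fp: "curvature_fun (polar_body (K i)) v * ?p ^ (?n + 1) = ?J"
        using curvature_fun_eq_dual_jacobian[OF regular_body_polar[OF Ki] v0]
        by (simp only: sphere(2)[OF v] polar_polar[OF cb])
      moreover have "?J / ?p ^ ?n = ?p * curvature_fun (polar_body (K i)) v"
        unfolding Fp[symmetric] using p by simp
      ultimately show ?thesis by simp
    qed
    have "G u * c = (\<Prod>i=1..?n. (b i u * c) powr (1 / real ?n))"
      unfolding G_def using c less_imp_le[OF b_pos[OF _ u]] by (intro prod_powr_mult_const) auto
    also have "\<dots> = (\<Prod>i=1..?n. (\<phi> i (1 / (curvature_fun (polar_body (K i)) v * support_fun (polar_body (K i)) v ^ (?n + 1)))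
        * support_fun (polar_body (K i)) v * curvature_fun (polar_body (K i)) v) powr (1 / real ?n))"
      by (intro prod.cong refl) (simp only: eq)
    finally show "G (sgn (dual_map L v)) * (\<bar>dual_jacobian L v\<bar> / norm (dual_map L v) ^ ?n) = \<dots>"
      using J by (simp add: u_def c_def)
  qed
  finally show ?thesis .
qed

theorem proposition2p2:
  fixes K :: "nat \<Rightarrow> (real^'n) set"
    and L :: "(real^'n) set"
    and l :: "nat \<Rightarrow> real"
    and \<phi> :: "nat \<Rightarrow> real \<Rightarrow> real"
  assumes "2 \<le> CARD('n)"
    and "\<And>i. i \<in> {1..CARD('n)} \<Longrightarrow> K i \<in> C2_plus"
    and "L \<in> C2_plus"
    and "\<And>i. i \<in> {1..CARD('n)} \<Longrightarrow> 0 < l i"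
    and "\<And>i. i \<in> {1..CARD('n)} \<Longrightarrow> K i = (\<lambda>x. l i *\<^sub>R x) ` L"
    and "\<And>i. i \<in> {1..CARD('n)} \<Longrightarrow> \<phi> i \<in> Conc"
  shows "mixed_affine_area_star \<phi> K = mixed_affine_area \<phi> (\<lambda>i. polar_body (K i)) \<and>
         mixed_affine_area_star \<phi> (\<lambda>_. L) = mixed_affine_area \<phi> (\<lambda>_. polar_body L)"
proof
  show "mixed_affine_area_star \<phi> K = mixed_affine_area \<phi> (\<lambda>i. polar_body (K i))"
    using assms by (intro mixed_affine_area_star_eq_polar[where L = L and l = l] C2_plus_regular)
  show "mixed_affine_area_star \<phi> (\<lambda>_. L) = mixed_affine_area \<phi> (\<lambda>_. polar_body L)"
    using assms(3,6) by (intro mixed_affine_area_star_eq_polar[where L = L and l = "\<lambda>_. 1"] C2_plus_regular) auto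
qed

end
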